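(* There exists $A_*\in(1,\infty)$ such that $\mu_0^{\mathrm{even}}(2)>0$ for every $a\in(1/2,A_*]$.
   Context: For $a>1/2$ put $A(s)=\sqrt{a\cosh(2s)+\tfrac12}$, $B(s)=\sqrt{a\cosh(2s)-\tfrac12}$, $K=K(a)=\sqrt{a^2-\tfrac14}$, and $\varphi(s)=\int_0^s\frac{K}{A(t)^2B(t)}\,dt$. Let $s_0=s_0(a)>0$ be the unique positive solution of $\tanh\varphi(s_0)=\frac{B(s_0)K}{a\sinh(2s_0)}$, and let $r(a)>0$ be defined by $\cosh r(a)=A(s_0)\cosh\varphi(s_0)$. (These are the data of the critical spherical catenoid $\Sigma_a$ in the geodesic ball of radius $r(a)$ of $\mathbb{H}^3$, with $|\mathrm{II}|^2=2K^2/B^4$.) Set $W_2(s)=2K^2/B(s)^4-2-4/B(s)^2$ and, for $u\in H^1((-s_0,s_0))$, $$\mathcal{S}_2^{\mathrm{rad}}(u,u)=\int_{-s_0}^{s_0}\bigl[B(u')^2-BW_2u^2\bigr]ds-\coth r(a)\,B(s_0)\bigl[u(s_0)^2+u(-s_0)^2\bigr].$$ $\mu_0^{\mathrm{even}}(2)$ (which depends on $a$) is the lowest eigenvalue of $\mathcal{S}_2^{\mathrm{rad}}$ relative to the norm $\int_{-s_0}^{s_0}Bu^2ds$, restricted to functions even under $s\mapsto-s$. *)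

theory Defs
  imports "HOL-Analysis.Analysis"
begin

definition cat_A :: "real \<Rightarrow> real \<Rightarrow> real" where
  "cat_A a s = sqrt (a * cosh (2 * s) + 1 / 2)"

definition cat_B :: "real \<Rightarrow> real \<Rightarrow> real" where
  "cat_B a s = sqrt (a * cosh (2 * s) - 1 / 2)"

definition cat_K :: "real \<Rightarrow> real" where
  "cat_K a = sqrt (a\<^sup>2 - 1 / 4)"

definition cat_phi :: "real \<Rightarrow> real \<Rightarrow> real" where
  "cat_phi a s = (LBINT t=0..s. cat_K a / ((cat_A a t)\<^sup>2 * cat_B a t))"

definition cat_s0 :: "real \<Rightarrow> real" where
  "cat_s0 a = (THE s. s > 0 \<and>
     tanh (cat_phi a s) = cat_B a s * cat_K a / (a * sinh (2 * s)))"

definition cat_r :: "real \<Rightarrow> real" where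
  "cat_r a = (THE r. r > 0 \<and>
     cosh r = cat_A a (cat_s0 a) * cosh (cat_phi a (cat_s0 a)))"

definition W2 :: "real \<Rightarrow> real \<Rightarrow> real" where
  "W2 a s = 2 * (cat_K a)\<^sup>2 / (cat_B a s) ^ 4 - 2 - 4 / (cat_B a s)\<^sup>2"

definition L2_on :: "real set \<Rightarrow> (real \<Rightarrow> real) \<Rightarrow> bool" where
  "L2_on I f \<longleftrightarrow> set_borel_measurable lborel I f \<and> set_integrable lborel I (\<lambda>x. (f x)\<^sup>2)"

definition C1c_on :: "real set \<Rightarrow> (real \<Rightarrow> real) \<Rightarrow> bool" where
  "C1c_on I \<eta> \<longleftrightarrow> \<eta> C1_differentiable_on UNIV \<and>
     (\<exists>C. compact C \<and> C \<subseteq> I \<and> (\<forall>x. x \<notin> C \<longrightarrow> \<eta> x = 0))"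

definition is_weak_deriv :: "real \<Rightarrow> (real \<Rightarrow> real) \<Rightarrow> (real \<Rightarrow> real) \<Rightarrow> bool" where
  "is_weak_deriv c u g \<longleftrightarrow> L2_on {-c<..<c} g \<and>
     (\<forall>\<eta>. C1c_on {-c<..<c} \<eta> \<longrightarrow>
        (LBINT x:{-c<..<c}. u x * deriv \<eta> x) = - (LBINT x:{-c<..<c}. g x * \<eta> x))"

text \<open>
  An element of \<open>H\<^sup>1((-c, c))\<close> is represented by its unique representative that is continuous
  on the closed interval, so that the boundary values \<open>u c\<close> and \<open>u (-c)\<close> are the traces.
  Values outside \<open>[-c, c]\<close> are irrelevant. As is usual in dimension one, the test functions are
  \<open>C\<^sup>1\<close> with compact support; smooth ones would give the same space.
\<close>

definition H1 :: "real \<Rightarrow> (real \<Rightarrow> real) set" where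
  "H1 c = {u. continuous_on {-c..c} u \<and> L2_on {-c<..<c} u \<and> (\<exists>g. is_weak_deriv c u g)}"

text \<open>
  The weak derivative is determined only almost everywhere; it is used only under integrals, where
  the choice does not matter.
\<close>

definition weak_deriv :: "real \<Rightarrow> (real \<Rightarrow> real) \<Rightarrow> real \<Rightarrow> real" where
  "weak_deriv c u = (SOME g. is_weak_deriv c u g)"

text \<open>
  The symmetric bilinear form whose diagonal is the quadratic form
  \<open>\<integral> [B (u')\<^sup>2 - B W\<^sub>2 u\<^sup>2] ds - coth r(a) B(s\<^sub>0) [u(s\<^sub>0)\<^sup>2 + u(-s\<^sub>0)\<^sup>2]\<close>;
  the factor \<open>cosh r / sinh r\<close> is \<open>coth r\<close>.
\<close>

definition S2_rad :: "real \<Rightarrow> (real \<Rightarrow> real) \<Rightarrow> (real \<Rightarrow> real) \<Rightarrow> real" where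
  "S2_rad a u v = (let c = cat_s0 a; r = cat_r a in
     (LBINT s:{-c<..<c}. cat_B a s * (weak_deriv c u s * weak_deriv c v s)
                          - cat_B a s * W2 a s * (u s * v s))
     - cosh r / sinh r * cat_B a c * (u c * v c + u (-c) * v (-c)))"

definition B_inner :: "real \<Rightarrow> (real \<Rightarrow> real) \<Rightarrow> (real \<Rightarrow> real) \<Rightarrow> real" where
  "B_inner a u v = (LBINT s:{-cat_s0 a<..<cat_s0 a}. cat_B a s * (u s * v s))"

definition H1_even :: "real \<Rightarrow> (real \<Rightarrow> real) set" where
  "H1_even c = {u \<in> H1 c. \<forall>s\<in>{-c..c}. u (-s) = u s}"

definition even_eigenvalue :: "real \<Rightarrow> real \<Rightarrow> bool" where
  "even_eigenvalue a \<mu> \<longleftrightarrow>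
     (\<exists>u\<in>H1_even (cat_s0 a). (\<exists>s\<in>{-cat_s0 a..cat_s0 a}. u s \<noteq> 0) \<and>
        (\<forall>v\<in>H1_even (cat_s0 a). S2_rad a u v = \<mu> * B_inner a u v))"

definition mu0_even :: "real \<Rightarrow> real" where
  "mu0_even a = (LEAST \<mu>. even_eigenvalue a \<mu>)"

end

theory Submission
  imports Defs
begin

text \<open>
  Why the lowest even eigenvalue is positive up to some \<open>A > 1\<close>.

  The profile \<open>B\<close> itself is the supersolution to start from. Write \<open>y = B\<^sup>2\<close>. From
  \<open>(a sinh 2s)\<^sup>2 = y\<^sup>2 + y - K\<^sup>2\<close> one computes \<open>(B B')' + B W\<^sub>2 B = (2 K\<^sup>2 - 3 y) / y\<close>, while the free
  boundary condition that determines \<open>s\<^sub>0\<close> and \<open>r\<close> says exactly that \<open>coth r B = B'\<close> at \<open>s\<^sub>0\<close>, so \<open>B\<close>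
  satisfies the Robin condition with equality (\<open>coth_r_cat_B\<close>). As \<open>y\<close> is smallest at
  \<open>s = 0\<close>, where \<open>y = a - 1/2\<close> and \<open>K\<^sup>2 = y (y + 1)\<close>, the right-hand side is nonpositive on the whole
  interval exactly when \<open>a \<le> 1\<close>; then \<open>B\<close> is a positive supersolution. For \<open>a\<close>
  slightly above 1 the sign fails only near \<open>s = 0\<close>, and it is repaired by
  \<open>\<rho> = B + \<eta> / B\<^sup>2 - \<theta> / B\<close>: the term \<open>\<eta> / B\<^sup>2\<close> pushes down near the neck, where \<open>B\<close> is small, and
  \<open>- \<theta> / B\<close> restores the Robin inequality, which works as soon as \<open>B(s\<^sub>0) \<ge> 3 \<eta> / (2 \<theta>)\<close>.

  A supersolution turns into a statement about eigenvalues by shooting. Let \<open>w\<close> solve the equation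
  with spectral parameter \<open>\<mu>\<close> and even initial data \<open>w(0) = 1\<close>, \<open>w'(0) = 0\<close>, and call \<open>\<mu>\<close> subcritical
  if \<open>w > 0\<close> on \<open>[0, s\<^sub>0]\<close> and the Robin expression of \<open>w\<close> at \<open>s\<^sub>0\<close> is strictly positive. Comparing
  Wronskians with \<open>\<rho>\<close> shows that \<open>\<mu> = 0\<close> is subcritical
  (\<open>supersolution_imp_subcritical_0\<close>). Subcritical parameters form an open set that is bounded
  above; at their supremum \<open>\<mu>\<^sub>0 > 0\<close> the solution is still positive, because a nontrivial solution
  has no double zero, and it satisfies the Robin condition (\<open>ground_state_exists\<close>). So \<open>\<mu>\<^sub>0\<close> is an
  eigenvalue with a positive eigenfunction \<open>w\<close>. Jacobi's identity
  \<open>S(u,u) - \<mu>\<^sub>0 \<integral> B u\<^sup>2 = \<integral> B (u' - (w'/w) u)\<^sup>2\<close> then bounds every eigenvalue below by \<open>\<mu>\<^sub>0\<close>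
  (\<open>ground_state_minimal\<close>), so the least even eigenvalue exists and equals \<open>\<mu>\<^sub>0 > 0\<close>.

  Two pieces of general theory carry this: weakly differentiable functions on an interval are
  primitives of their weak derivatives and obey the product rule
  (\<open>is_weak_deriv_imp_primitive_on\<close>, \<open>primitive_on_mult\<close>), and linear systems are solvable with
  continuous dependence on parameters (\<open>linear_system_solution\<close>, \<open>gronwall_upper\<close>).
\<close>

section \<open>Absolutely continuous functions as primitives\<close>

text \<open>
  Absolute continuity of \<open>u\<close> with a chosen density \<open>g\<close> of its derivative. The density is part of the
  relation because a weak derivative is an arbitrary member of its class modulo null sets.
\<close>
definition primitive_on :: "real \<Rightarrow> real \<Rightarrow> (real \<Rightarrow> real) \<Rightarrow> (real \<Rightarrow> real) \<Rightarrow> bool" where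
  "primitive_on a b u g \<longleftrightarrow> set_integrable lborel {a<..<b} g \<and>
     (\<forall>x y. a \<le> x \<longrightarrow> x \<le> y \<longrightarrow> y \<le> b \<longrightarrow> u y - u x = (LBINT t:{x<..<y}. g t))"

lemma set_integral_split:
  fixes g :: "real \<Rightarrow> real"
  assumes "set_integrable lborel {a<..<b} g" "a \<le> x" "x \<le> y" "y \<le> z" "z \<le> b"
  shows "(LBINT t:{x<..<z}. g t) = (LBINT t:{x<..<y}. g t) + (LBINT t:{y<..<z}. g t)"
proof -
  have i: "interval_lebesgue_integrable lborel (ereal x) (ereal z) g"
    unfolding interval_lebesgue_integrable_def
    using assms by (auto intro: set_integrable_subset)
  have "(LBINT t=x..y. g t) + (LBINT t=y..z. g t) = (LBINT t=x..z. g t)"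
    by (rule interval_integral_sum) (use assms i in \<open>auto simp: min_absorb1 max_absorb2\<close>)
  then show ?thesis using assms by (simp add: interval_integral_Ioo)
qed

lemma set_integrable_mult_continuous:
  fixes g u :: "real \<Rightarrow> real"
  assumes g: "set_integrable lborel {a<..<b} g" and u: "continuous_on {a..b} u"
  shows "set_integrable lborel {a<..<b} (\<lambda>x. g x * u x)"
proof -
  have "compact (u ` {a..b})" by (intro compact_continuous_image u) auto
  then obtain C where "\<forall>y\<in>u ` {a..b}. norm y \<le> C"
    using compact_imp_bounded bounded_iff by metis
  then have C: "\<And>x. x \<in> {a..b} \<Longrightarrow> norm (u x) \<le> C" by blast
  have m: "(\<lambda>x. (indicator {a<..<b} x *\<^sub>R g x) * (indicator {a<..<b} x *\<^sub>R u x)) \<in> borel_measurable lborel"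
  proof (intro borel_measurable_times)
    show "(\<lambda>x. indicator {a<..<b} x *\<^sub>R g x) \<in> borel_measurable lborel"
      using g unfolding set_integrable_def by auto
    have "continuous_on {a<..<b} u" by (rule continuous_on_subset[OF u]) auto
    then have "(\<lambda>x. indicator {a<..<b} x *\<^sub>R u x) \<in> borel_measurable borel"
      by (intro borel_measurable_continuous_on_indicator) auto
    then show "(\<lambda>x. indicator {a<..<b} x *\<^sub>R u x) \<in> borel_measurable lborel" by simp
  qed
  show ?thesis unfolding set_integrable_def
  proof (rule Bochner_Integration.integrable_bound)
    show "integrable lborel (\<lambda>x. C * (indicator {a<..<b} x *\<^sub>R g x))"
      using g unfolding set_integrable_def by auto
    show "(\<lambda>x. indicator {a<..<b} x *\<^sub>R (g x * u x)) \<in> borel_measurable lborel"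
      by (rule measurable_cong[THEN iffD1, OF _ m]) (auto split: split_indicator)
    show "AE x in lborel. norm (indicator {a<..<b} x *\<^sub>R (g x * u x)) \<le> norm (C * (indicator {a<..<b} x *\<^sub>R g x))"
    proof (rule AE_I2)
      fix x
      show "norm (indicator {a<..<b} x *\<^sub>R (g x * u x)) \<le> norm (C * (indicator {a<..<b} x *\<^sub>R g x))"
      proof (cases "x \<in> {a<..<b}")
        case True
        then have "\<bar>u x\<bar> \<le> C" using C[of x] by auto
        then have "\<bar>u x\<bar> \<le> \<bar>C\<bar>" by linarith
        then have "\<bar>g x\<bar> * \<bar>u x\<bar> \<le> \<bar>g x\<bar> * \<bar>C\<bar>" by (intro mult_left_mono) auto
        then show ?thesis using True by (simp add: abs_mult mult.commute)
      qed auto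
    qed
  qed
qed

lemma continuous_imp_set_integrable_Ioo:
  fixes u :: "real \<Rightarrow> real"
  assumes "continuous_on {a..b} u"
  shows "set_integrable lborel {a<..<b} u"
  by (rule set_integrable_subset[OF borel_integrable_atLeastAtMost'[OF assms]]) auto

text \<open>
  On a short interval the increment of \<open>u v\<close> is \<open>\<integral> g v(y) + u(x) h\<close>, so it differs from
  \<open>\<integral> g v + h u\<close> by at most the oscillation of \<open>u\<close> and \<open>v\<close> times \<open>\<integral> |g| + |h|\<close>. This error bound is
  additive over adjacent intervals, so bisection transfers it to the whole interval with an
  arbitrarily small oscillation.
\<close>
lemma primitive_on_mult:
  assumes 1: "primitive_on a b u g" and 2: "primitive_on a b v h"
    and cu: "continuous_on {a..b} u" and cv: "continuous_on {a..b} v"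
  shows "primitive_on a b (\<lambda>x. u x * v x) (\<lambda>x. g x * v x + h x * u x)"
proof -
  define f where "f = (\<lambda>x. g x * v x + h x * u x)"
  define M where "M = (\<lambda>x. \<bar>g x\<bar> + \<bar>h x\<bar>)"
  have g: "set_integrable lborel {a<..<b} g" and h: "set_integrable lborel {a<..<b} h"
    using 1 2 by (auto simp: primitive_on_def)
  have fi: "set_integrable lborel {a<..<b} f"
    unfolding f_def by (intro set_integral_add set_integrable_mult_continuous g h cu cv)
  have Mi: "set_integrable lborel {a<..<b} M"
    unfolding M_def by (intro set_integral_add set_integrable_abs g h)
  have sub: "set_integrable lborel {x<..<y} k" if "set_integrable lborel {a<..<b} k" "a \<le> x" "y \<le> b"
    for k :: "real \<Rightarrow> real" and x y
    by (rule set_integrable_subset[OF that(1)]) (use that in auto)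
  define \<Delta> where "\<Delta> x y = u y * v y - u x * v x - (LBINT t:{x<..<y}. f t)" for x y
  have \<Delta>_small: "\<bar>\<Delta> x y\<bar> \<le> e * (LBINT t:{x<..<y}. M t)" if e: "e > 0" and xy: "a \<le> x" "x \<le> y" "y \<le> b" for e x y
  proof -
    define P where "P x y \<longleftrightarrow> (a \<le> x \<and> x \<le> y \<and> y \<le> b \<longrightarrow> \<bar>\<Delta> x y\<bar> \<le> e * (LBINT t:{x<..<y}. M t))" for x y
    have "P x y"
      using \<open>x \<le> y\<close>
    proof (induction rule: Bolzano)
      case (trans p q r)
      show ?case unfolding P_def
      proof (intro impI, elim conjE)
        assume *: "a \<le> p" "p \<le> r" "r \<le> b"
        have "\<Delta> p r = \<Delta> p q + \<Delta> q r"
          using set_integral_split[OF fi, of p q r] * trans unfolding \<Delta>_def by auto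
        moreover have "\<bar>\<Delta> p q\<bar> \<le> e * (LBINT t:{p<..<q}. M t)" "\<bar>\<Delta> q r\<bar> \<le> e * (LBINT t:{q<..<r}. M t)"
          using trans * unfolding P_def by auto
        ultimately show "\<bar>\<Delta> p r\<bar> \<le> e * (LBINT t:{p<..<r}. M t)"
          using set_integral_split[OF Mi, of p q r] * trans by (auto simp: algebra_simps)
      qed
    next
      case (local z)
      then have z: "z \<in> {a..b}" using xy by auto
      obtain d1 where d1: "d1 > 0" "\<And>t. t \<in> {a..b} \<Longrightarrow> dist t z < d1 \<Longrightarrow> dist (u t) (u z) < e/2"
        using cu[unfolded continuous_on_iff, rule_format, OF z, of "e/2"] e by auto
      obtain d2 where d2: "d2 > 0" "\<And>t. t \<in> {a..b} \<Longrightarrow> dist t z < d2 \<Longrightarrow> dist (v t) (v z) < e/2"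
        using cv[unfolded continuous_on_iff, rule_format, OF z, of "e/2"] e by auto
      show ?case
      proof (intro exI conjI allI impI, goal_cases)
        show "min d1 d2 > 0" using d1 d2 by auto
        fix p q assume pq: "p \<le> z \<and> z \<le> q \<and> q - p < min d1 d2"
        show "P p q" unfolding P_def
        proof (intro impI, elim conjE)
          assume *: "a \<le> p" "p \<le> q" "q \<le> b"
          have near: "\<bar>u t - u s\<bar> \<le> e \<and> \<bar>v t - v s\<bar> \<le> e" if "t \<in> {p..q}" "s \<in> {p..q}" for t s
          proof -
            have tri: "\<bar>r - s'\<bar> \<le> e" if "\<bar>r - m\<bar> < e/2" "\<bar>s' - m\<bar> < e/2" for r s' m :: real
              using that by linarith
            have "dist t z < d1" "dist s z < d1" "dist t z < d2" "dist s z < d2" "t \<in> {a..b}" "s \<in> {a..b}"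
              using that pq * by (auto simp: dist_real_def)
            then show ?thesis using d1(2)[of t] d1(2)[of s] d2(2)[of t] d2(2)[of s]
              unfolding dist_real_def by (blast intro: tri)
          qed
          have gi: "set_integrable lborel {p<..<q} g" and hi: "set_integrable lborel {p<..<q} h"
            and fi': "set_integrable lborel {p<..<q} f" and Mi': "set_integrable lborel {p<..<q} M"
            using sub[OF g] sub[OF h] sub[OF fi] sub[OF Mi] * by auto
          have "u q * v q - u p * v p = (u q - u p) * v q + u p * (v q - v p)" by (simp add: algebra_simps)
          also have "\<dots> = (LBINT t:{p<..<q}. g t) * v q + u p * (LBINT t:{p<..<q}. h t)"
            using 1 2 * by (simp add: primitive_on_def)
          also have "\<dots> = (LBINT t:{p<..<q}. g t * v q + u p * h t)"
            using gi hi by (subst set_integral_add(2)) auto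
          finally have "\<Delta> p q = (LBINT t:{p<..<q}. (g t * v q + u p * h t) - f t)"
            unfolding \<Delta>_def using gi hi fi' by (subst set_integral_diff(2)) (auto intro!: set_integral_add)
          moreover have "\<bar>LBINT t:{p<..<q}. (g t * v q + u p * h t) - f t\<bar> \<le> (LBINT t:{p<..<q}. e * M t)"
          proof -
            have i: "set_integrable lborel {p<..<q} (\<lambda>t. (g t * v q + u p * h t) - f t)"
              using gi hi fi' by (intro set_integral_diff set_integral_add) auto
            have "\<bar>LBINT t:{p<..<q}. (g t * v q + u p * h t) - f t\<bar>
               \<le> (LBINT t:{p<..<q}. \<bar>(g t * v q + u p * h t) - f t\<bar>)"
              unfolding set_lebesgue_integral_def
              by (rule order_trans[OF integral_abs_bound]) (simp add: abs_mult)
            also have "\<dots> \<le> (LBINT t:{p<..<q}. e * M t)"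
            proof (rule set_integral_mono)
              show "set_integrable lborel {p<..<q} (\<lambda>t. \<bar>(g t * v q + u p * h t) - f t\<bar>)"
                by (rule set_integrable_abs[OF i])
              show "set_integrable lborel {p<..<q} (\<lambda>t. e * M t)" using Mi' by auto
              fix t assume t: "t \<in> {p<..<q}"
              have "(g t * v q + u p * h t) - f t = g t * (v q - v t) + h t * (u p - u t)"
                unfolding f_def by (simp add: algebra_simps)
              also have "\<bar>\<dots>\<bar> \<le> \<bar>g t\<bar> * \<bar>v q - v t\<bar> + \<bar>h t\<bar> * \<bar>u p - u t\<bar>"
                by (metis abs_mult abs_triangle_ineq)
              also have "\<dots> \<le> \<bar>g t\<bar> * e + \<bar>h t\<bar> * e"
                using near[of q t] near[of p t] t by (intro add_mono mult_left_mono) auto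
              finally show "\<bar>(g t * v q + u p * h t) - f t\<bar> \<le> e * M t" by (simp add: M_def algebra_simps)
            qed
            finally show ?thesis .
          qed
          ultimately show "\<bar>\<Delta> p q\<bar> \<le> e * (LBINT t:{p<..<q}. M t)" by simp
        qed
      qed
    qed
    then show ?thesis using xy by (simp add: P_def)
  qed
  have "\<Delta> x y = 0" if xy: "a \<le> x" "x \<le> y" "y \<le> b" for x y
  proof (rule ccontr)
    assume "\<Delta> x y \<noteq> 0"
    define L where "L = (LBINT t:{x<..<y}. M t)"
    have L: "L \<ge> 0" unfolding L_def set_lebesgue_integral_def M_def by (intro integral_nonneg_AE) auto
    have "\<bar>\<Delta> x y\<bar> \<le> (\<bar>\<Delta> x y\<bar> / (2 * (L + 1))) * L"
      using \<Delta>_small[of "\<bar>\<Delta> x y\<bar> / (2 * (L + 1))" x y] xy L \<open>\<Delta> x y \<noteq> 0\<close> unfolding L_def by auto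
    also have "\<dots> = \<bar>\<Delta> x y\<bar> * (L / (2 * (L + 1)))" by simp
    also have "\<dots> < \<bar>\<Delta> x y\<bar> * 1" using L \<open>\<Delta> x y \<noteq> 0\<close> by (intro mult_strict_left_mono) (auto simp: field_simps)
    also have "\<dots> = \<bar>\<Delta> x y\<bar>" by simp
    finally show False by simp
  qed
  then show ?thesis using fi unfolding primitive_on_def \<Delta>_def f_def by auto
qed

lemma C1_imp_primitive_on:
  assumes "\<And>x. a \<le> x \<Longrightarrow> x \<le> b \<Longrightarrow> (w has_real_derivative w' x) (at x)" "continuous_on {a..b} w'"
  shows "primitive_on a b w w'"
  unfolding primitive_on_def
proof (intro conjI allI impI)
  show "set_integrable lborel {a<..<b} w'" by (rule continuous_imp_set_integrable_Ioo) fact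
  fix x y assume "a \<le> x" "x \<le> y" "y \<le> b"
  have "(LBINT t=x..y. w' t) = w y - w x"
    by (rule interval_integral_FTC_finite)
       (use assms \<open>a \<le> x\<close> \<open>x \<le> y\<close> \<open>y \<le> b\<close> in \<open>auto simp: min_def max_def
          intro: continuous_on_subset has_field_derivative_at_within simp flip: has_real_derivative_iff_has_vector_derivative\<close>)
  then show "w y - w x = (LBINT t:{x<..<y}. w' t)" using \<open>x \<le> y\<close> by (simp add: interval_integral_Ioo)
qed

section \<open>Weak derivatives on an interval\<close>

lemma DERIV_max_0_power2: "((\<lambda>x::real. (max 0 x)\<^sup>2) has_real_derivative 2 * max 0 x) (at x)"
proof -
  consider "x < 0" | "x > 0" | "x = 0" by linarith
  then show ?thesis
  proof cases
    case 1
    have "((\<lambda>x::real. 0) has_real_derivative 0) (at x)" by simp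
    then have "((\<lambda>x::real. (max 0 x)\<^sup>2) has_real_derivative 0) (at x)"
      by (rule has_field_derivative_transform_within_open[where S="{..<0}"]) (use 1 in auto)
    then show ?thesis using 1 by simp
  next
    case 2
    have "((\<lambda>x::real. x\<^sup>2) has_real_derivative 2 * x) (at x)" by (auto intro!: derivative_eq_intros)
    then have "((\<lambda>x::real. (max 0 x)\<^sup>2) has_real_derivative 2 * x) (at x)"
      by (rule has_field_derivative_transform_within_open[where S="{0<..}"]) (use 2 in auto)
    then show ?thesis using 2 by simp
  next
    case 3
    have "((\<lambda>h::real. max 0 h) \<longlongrightarrow> 0) (at 0)"
      by (rule tendsto_eq_rhs, rule tendsto_max[OF tendsto_const tendsto_ident_at]) simp
    then have "((\<lambda>h::real. (max 0 h)\<^sup>2 / h) \<longlongrightarrow> 0) (at 0)"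
      by (rule Lim_transform_within[where d=1]) (auto simp: max_def power2_eq_square)
    then show ?thesis using 3 by (simp add: DERIV_def)
  qed
qed

text \<open>
  The integral of the triangular hat function on \<open>[0, 1]\<close>: an explicit \<open>C\<^sup>1\<close> step from 0 to 1,
  which supplies the test functions.
\<close>
definition smooth_step :: "real \<Rightarrow> real" where
  "smooth_step x = 2 * ((max 0 x)\<^sup>2 - 2 * (max 0 (x - 1/2))\<^sup>2 + (max 0 (x - 1))\<^sup>2)"

definition hat :: "real \<Rightarrow> real" where
  "hat x = 4 * (max 0 x - 2 * max 0 (x - 1/2) + max 0 (x - 1))"

lemma DERIV_smooth_step: "(smooth_step has_real_derivative hat x) (at x)"
proof -
  have s: "((\<lambda>x::real. (max 0 (x - c))\<^sup>2) has_real_derivative 2 * max 0 (x - c)) (at x)" for c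
  proof -
    have "((\<lambda>x. x - c) has_real_derivative 1) (at x)" by (auto intro!: derivative_eq_intros)
    from DERIV_chain2[OF DERIV_max_0_power2 this] show ?thesis by simp
  qed
  show ?thesis unfolding smooth_step_def[abs_def] hat_def
    by (rule derivative_eq_intros DERIV_max_0_power2 s refl | simp)+
qed

lemma hat_nonneg: "hat x \<ge> 0" by (auto simp: hat_def max_def)
lemma hat_eq_0: "x \<le> 0 \<or> x \<ge> 1 \<Longrightarrow> hat x = 0" by (auto simp: hat_def max_def)
lemma continuous_on_hat: "continuous_on S hat"
  unfolding hat_def[abs_def] by (intro continuous_intros)
lemma smooth_step_mono: "x \<le> y \<Longrightarrow> smooth_step x \<le> smooth_step y"
  by (rule DERIV_nonneg_imp_nondecreasing) (use DERIV_smooth_step hat_nonneg in blast)+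
lemma smooth_step_eq_0: "x \<le> 0 \<Longrightarrow> smooth_step x = 0" by (auto simp: smooth_step_def max_def)
lemma smooth_step_eq_1: "x \<ge> 1 \<Longrightarrow> smooth_step x = 1"
  by (auto simp: smooth_step_def max_def power2_eq_square algebra_simps)
lemma smooth_step_bounds: "0 \<le> smooth_step x" "smooth_step x \<le> 1"
  using smooth_step_mono[of "min 0 x" x] smooth_step_mono[of x "max 1 x"]
  by (auto simp: smooth_step_eq_0 smooth_step_eq_1)

lemma L2_on_imp_set_integrable:
  assumes "L2_on {a<..<b} g"
  shows "set_integrable lborel {a<..<b} g"
proof (rule set_integrable_bound)
  show "set_integrable lborel {a<..<b} (\<lambda>x. 1 + (g x)\<^sup>2)"
    using assms unfolding L2_on_def
    by (intro set_integral_add) (auto intro: continuous_imp_set_integrable_Ioo)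
  show "set_borel_measurable lborel {a<..<b} g" using assms by (simp add: L2_on_def)
  have "\<bar>r\<bar> \<le> 1 + r\<^sup>2" for r :: real
    using zero_le_power2[of "\<bar>r\<bar> - 1"] by (simp add: power2_diff)
  then show "AE x in lborel. x \<in> {a<..<b} \<longrightarrow> norm (g x) \<le> norm (1 + (g x)\<^sup>2)"
    by (auto simp: abs_of_nonneg add_nonneg_nonneg)
qed

text \<open>Applied to narrow rescaled hat functions, this recovers the point values of \<open>u\<close>.\<close>
lemma integral_concentrated_kernel:
  fixes u K :: "real \<Rightarrow> real"
  assumes u: "continuous_on {a..b} u" and K: "continuous_on {a..b} K" "\<And>x. K x \<ge> 0"
    and K1: "(LBINT x:{a<..<b}. K x) = 1"
    and near: "\<And>x. a < x \<Longrightarrow> x < b \<Longrightarrow> K x \<noteq> 0 \<Longrightarrow> \<bar>u x - z\<bar> \<le> e"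
  shows "\<bar>(LBINT x:{a<..<b}. u x * K x) - z\<bar> \<le> e"
proof -
  have i: "set_integrable lborel {a<..<b} (\<lambda>x. u x * K x)" "set_integrable lborel {a<..<b} (\<lambda>x. z * K x)"
    "set_integrable lborel {a<..<b} (\<lambda>x. e * K x)" "set_integrable lborel {a<..<b} (\<lambda>x. \<bar>u x * K x - z * K x\<bar>)"
    by (auto intro!: continuous_imp_set_integrable_Ioo continuous_on_mult continuous_on_rabs continuous_on_diff continuous_on_const u K(1))
  have "(LBINT x:{a<..<b}. u x * K x) - z = (LBINT x:{a<..<b}. u x * K x - z * K x)"
    using i K1 by (subst set_integral_diff) auto
  also have "\<bar>\<dots>\<bar> \<le> (LBINT x:{a<..<b}. \<bar>u x * K x - z * K x\<bar>)"
    unfolding set_lebesgue_integral_def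
    by (rule order_trans[OF integral_abs_bound]) (simp add: abs_mult)
  also have "\<dots> \<le> (LBINT x:{a<..<b}. e * K x)"
  proof (rule set_integral_mono[OF i(4,3)])
    fix x assume x: "x \<in> {a<..<b}"
    have "\<bar>u x * K x - z * K x\<bar> = \<bar>u x - z\<bar> * K x"
      using K(2)[of x] by (simp add: abs_mult flip: left_diff_distrib)
    also have "\<dots> \<le> e * K x" using near[of x] x K(2)[of x] by (cases "K x = 0") (auto intro: mult_right_mono)
    finally show "\<bar>u x * K x - z * K x\<bar> \<le> e * K x" .
  qed
  also have "\<dots> = e" using K1 by simp
  finally show ?thesis .
qed

lemma integral_scaled_hat:
  assumes "n > 0" "a \<le> b" "n * a + k \<le> 0" "n * b + k \<ge> 1"
  shows "(LBINT x:{a<..<b}. n * hat (n * x + k)) = 1"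
proof -
  have d: "((\<lambda>x. smooth_step (n * x + k)) has_real_derivative n * hat (n * x + k)) (at x)" for x
  proof -
    have "((\<lambda>x. n * x + k) has_real_derivative n) (at x)" by (auto intro!: derivative_eq_intros)
    from DERIV_chain2[OF DERIV_smooth_step this] show ?thesis by (simp add: mult.commute)
  qed
  have "primitive_on a b (\<lambda>x. smooth_step (n * x + k)) (\<lambda>x. n * hat (n * x + k))"
    by (rule C1_imp_primitive_on[OF d])
       (intro continuous_intros continuous_on_compose2[OF continuous_on_hat[of UNIV]], auto)
  then have "(LBINT x:{a<..<b}. n * hat (n * x + k)) = smooth_step (n * b + k) - smooth_step (n * a + k)"
    using assms unfolding primitive_on_def by auto
  then show ?thesis using assms by (simp add: smooth_step_eq_0 smooth_step_eq_1)
qed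

text \<open>
  The defining identity of the weak derivative is tested with \<open>C\<^sup>1\<close> plateaus that increase to the
  indicator of \<open>(x, y)\<close>. The derivatives of the plateaus concentrate at \<open>x\<close> and \<open>y\<close> and pick out
  \<open>u x - u y\<close> by continuity, while dominated convergence gives the integral of \<open>g\<close>.
\<close>
lemma is_weak_deriv_imp_primitive_on:
  assumes c: "c > 0" and u: "continuous_on {-c..c} u" and wd: "is_weak_deriv c u g"
  shows "primitive_on (-c) c u g"
proof -
  have gi: "set_integrable lborel {-c<..<c} g"
    using wd by (auto simp: is_weak_deriv_def intro: L2_on_imp_set_integrable)
  have main: "u y - u x = (LBINT t:{x<..<y}. g t)" if xy: "-c \<le> x" "x < y" "y \<le> c" for x y
  proof -
    \<comment> \<open>The steps take place on \<open>[x + 1/n, x + 2/n]\<close> and \<open>[y - 2/n, y - 1/n]\<close>, so that the support stays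
      compact in the open interval even if \<open>x\<close> or \<open>y\<close> is an end point.\<close>
    define \<eta> where "\<eta> n t = smooth_step (real n * t + (- real n * x - 1)) - smooth_step (real n * t + (2 - real n * y))" for n t
    define K1 where "K1 n t = real n * hat (real n * t + (- real n * x - 1))" for n t
    define K2 where "K2 n t = real n * hat (real n * t + (2 - real n * y))" for n t
    have contK: "continuous_on S (K1 n)" "continuous_on S (K2 n)" for S n
      unfolding K1_def[abs_def] K2_def[abs_def]
      by (intro continuous_intros continuous_on_compose2[OF continuous_on_hat[of UNIV]], auto)+
    have D: "(\<eta> n has_real_derivative (K1 n t - K2 n t)) (at t)" for n t
    proof -
      have *: "((\<lambda>x. smooth_step (m * x + k)) has_real_derivative m * hat (m * t + k)) (at t)" for m k
      proof -
        have "((\<lambda>x. m * x + k) has_real_derivative m) (at t)" by (auto intro!: derivative_eq_intros)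
        from DERIV_chain2[OF DERIV_smooth_step this] show ?thesis by (simp add: mult.commute)
      qed
      show ?thesis unfolding \<eta>_def[abs_def] K1_def K2_def by (intro DERIV_diff *)
    qed
    have test: "(LBINT t:{-c<..<c}. u t * (K1 n t - K2 n t)) = - (LBINT t:{-c<..<c}. g t * \<eta> n t)"
      if n: "real n * (y - x) \<ge> 4" for n
    proof -
      have n0: "n > 0" using n by (cases n) auto
      have "C1c_on {-c<..<c} (\<eta> n)"
        unfolding C1c_on_def
      proof (intro conjI exI[of _ "{x + 1 / n .. y - 1 / n}"] allI impI)
        show "\<eta> n C1_differentiable_on UNIV"
          unfolding C1_differentiable_on_def
          by (rule exI[of _ "\<lambda>t. K1 n t - K2 n t"])
             (use D contK in \<open>auto intro!: continuous_on_diff simp flip: has_real_derivative_iff_has_vector_derivative\<close>)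
        show "compact {x + 1 / n .. y - 1 / n}" by simp
        have "1 / real n > 0" using n0 by simp
        then show "{x + 1 / n .. y - 1 / n} \<subseteq> {-c<..<c}" using xy
          by (auto simp del: zero_less_divide_1_iff)
        fix t assume "t \<notin> {x + 1 / n .. y - 1 / n}"
        then have "real n * t < real n * (x + 1 / n) \<or> real n * t > real n * (y - 1 / n)"
          using n0 by (auto simp: not_le mult_less_cancel_left)
        then have "real n * t < real n * x + 1 \<or> real n * t > real n * y - 1"
          using n0 by (auto simp: algebra_simps)
        then show "\<eta> n t = 0"
        proof
          assume "real n * t < real n * x + 1"
          then show ?thesis unfolding \<eta>_def using n by (simp add: smooth_step_eq_0 algebra_simps)
        next
          assume "real n * t > real n * y - 1"
          then show ?thesis unfolding \<eta>_def using n by (simp add: smooth_step_eq_1 algebra_simps)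
        qed
      qed
      moreover have "deriv (\<eta> n) t = K1 n t - K2 n t" for t using D by (rule DERIV_imp_deriv)
      ultimately show ?thesis using wd by (auto simp: is_weak_deriv_def)
    qed
    have ev: "\<forall>\<^sub>F n in sequentially. real n * d \<ge> C" if "d > 0" for d C
    proof -
      obtain N where "C / d \<le> real N" using real_arch_simple by blast
      then have "real n * d \<ge> C" if "n \<ge> N" for n
        using \<open>d > 0\<close> that by (metis of_nat_le_iff order_trans pos_divide_le_eq)
      then show ?thesis unfolding eventually_sequentially by blast
    qed
    have yx: "y - x > 0" using xy by simp
    have lim1: "(\<lambda>n. LBINT t:{-c<..<c}. u t * K1 n t) \<longlonglongrightarrow> u x"
    proof (rule LIMSEQ_I)
      fix e :: real assume e: "e > 0"
      obtain d where d: "d > 0" "\<And>t. t \<in> {-c..c} \<Longrightarrow> dist t x < d \<Longrightarrow> dist (u t) (u x) < e/2"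
        using u[unfolded continuous_on_iff, rule_format, of x "e/2"] e xy by auto
      have "\<forall>\<^sub>F n in sequentially. \<bar>(LBINT t:{-c<..<c}. u t * K1 n t) - u x\<bar> \<le> e/2"
        using ev[OF \<open>d > 0\<close>, of 3] ev[OF yx, of 4]
      proof (eventually_elim)
        case (elim n)
        then have n0: "n > 0" by (cases n) auto
        show ?case
        proof (rule integral_concentrated_kernel[OF u contK(1)])
          show "K1 n t \<ge> 0" for t by (simp add: K1_def hat_nonneg)
          have "real n * y \<le> real n * c" "real n * (-c) \<le> real n * x"
            by (rule mult_left_mono; use xy in simp)+
          moreover have "real n * y - real n * x \<ge> 4" using elim by (simp add: right_diff_distrib)
          ultimately have "real n * - c + (- real n * x - 1) \<le> 0" "real n * c + (- real n * x - 1) \<ge> 1"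
            "real n * - c + (2 - real n * y) \<le> 0" "real n * c + (2 - real n * y) \<ge> 1"
            by (simp_all only: mult_minus_right mult_minus_left)
          then show "(LBINT t:{-c<..<c}. K1 n t) = 1" unfolding K1_def
            by (intro integral_scaled_hat) (use n0 c in simp_all)
          fix t assume t: "-c < t" "t < c" "K1 n t \<noteq> 0"
          have "hat (real n * t + (- real n * x - 1)) \<noteq> 0" using t by (auto simp: K1_def)
          then have "\<not> real n * t + (- real n * x - 1) \<le> 0" "\<not> real n * t + (- real n * x - 1) \<ge> 1"
            using hat_eq_0 by blast+
          then have "0 < real n * (t - x) - 1" "real n * (t - x) - 1 < 1" by (simp_all add: algebra_simps)
          then have "0 < real n * (t - x)" "real n * (t - x) < real n * d" using elim by linarith+
          then have "0 < t - x" "t - x < d" using n0 by (auto simp: zero_less_mult_iff)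
          then show "\<bar>u t - u x\<bar> \<le> e/2" using d(2)[of t] t by (auto simp: dist_real_def)
        qed
      qed
      then show "\<exists>no. \<forall>n\<ge>no. norm ((LBINT t:{-c<..<c}. u t * K1 n t) - u x) < e"
        unfolding eventually_sequentially using e by force
    qed
    have lim2: "(\<lambda>n. LBINT t:{-c<..<c}. u t * K2 n t) \<longlonglongrightarrow> u y"
    proof (rule LIMSEQ_I)
      fix e :: real assume e: "e > 0"
      obtain d where d: "d > 0" "\<And>t. t \<in> {-c..c} \<Longrightarrow> dist t y < d \<Longrightarrow> dist (u t) (u y) < e/2"
        using u[unfolded continuous_on_iff, rule_format, of y "e/2"] e xy by auto
      have "\<forall>\<^sub>F n in sequentially. \<bar>(LBINT t:{-c<..<c}. u t * K2 n t) - u y\<bar> \<le> e/2"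
        using ev[OF \<open>d > 0\<close>, of 3] ev[OF yx, of 4]
      proof (eventually_elim)
        case (elim n)
        then have n0: "n > 0" by (cases n) auto
        show ?case
        proof (rule integral_concentrated_kernel[OF u contK(2)])
          show "K2 n t \<ge> 0" for t by (simp add: K2_def hat_nonneg)
          have "real n * y \<le> real n * c" "real n * (-c) \<le> real n * x"
            by (rule mult_left_mono; use xy in simp)+
          moreover have "real n * y - real n * x \<ge> 4" using elim by (simp add: right_diff_distrib)
          ultimately have "real n * - c + (- real n * x - 1) \<le> 0" "real n * c + (- real n * x - 1) \<ge> 1"
            "real n * - c + (2 - real n * y) \<le> 0" "real n * c + (2 - real n * y) \<ge> 1"
            by (simp_all only: mult_minus_right mult_minus_left)
          then show "(LBINT t:{-c<..<c}. K2 n t) = 1" unfolding K2_def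
            by (intro integral_scaled_hat) (use n0 c in simp_all)
          fix t assume t: "-c < t" "t < c" "K2 n t \<noteq> 0"
          have "hat (real n * t + (2 - real n * y)) \<noteq> 0" using t by (auto simp: K2_def)
          then have "\<not> real n * t + (2 - real n * y) \<le> 0" "\<not> real n * t + (2 - real n * y) \<ge> 1"
            using hat_eq_0 by blast+
          then have "0 < real n * (t - y) + 2" "real n * (t - y) + 2 < 1" by (simp_all add: algebra_simps)
          then have "0 < real n * (y - t)" "real n * (y - t) < real n * d"
            using elim by (auto simp: algebra_simps)
          then have "0 < y - t" "y - t < d" using n0 by (auto simp: zero_less_mult_iff)
          then show "\<bar>u t - u y\<bar> \<le> e/2" using d(2)[of t] t by (auto simp: dist_real_def)
        qed
      qed
      then show "\<exists>no. \<forall>n\<ge>no. norm ((LBINT t:{-c<..<c}. u t * K2 n t) - u y) < e"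
        unfolding eventually_sequentially using e by force
    qed
    have "(\<lambda>n. LBINT t:{-c<..<c}. u t * (K1 n t - K2 n t)) \<longlonglongrightarrow> u x - u y"
    proof -
      have "(LBINT t:{-c<..<c}. u t * (K1 n t - K2 n t)) =
          (LBINT t:{-c<..<c}. u t * K1 n t) - (LBINT t:{-c<..<c}. u t * K2 n t)" for n
        by (subst set_integral_diff(2)[symmetric])
           (auto intro!: continuous_imp_set_integrable_Ioo continuous_on_mult u contK simp: algebra_simps)
      then show ?thesis using tendsto_diff[OF lim1 lim2] by simp
    qed
    moreover have "(\<lambda>n. LBINT t:{-c<..<c}. g t * \<eta> n t) \<longlonglongrightarrow> (LBINT t:{x<..<y}. g t)"
      unfolding set_lebesgue_integral_def
    \<comment> \<open>For small \<open>n\<close> the two steps overlap, hence the truncation to \<open>n (y - x) \<ge> 4\<close>.\<close>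
    proof (rule tendsto_cong[THEN iffD1, OF _ integral_dominated_convergence[where w="\<lambda>t. \<bar>indicator {-c<..<c} t *\<^sub>R g t\<bar>"
          and s="\<lambda>n t. if real n * (y - x) \<ge> 4 then indicator {-c<..<c} t *\<^sub>R (g t * \<eta> n t) else 0"]])
      show "\<forall>\<^sub>F n in sequentially. (LINT t|lborel. (if 4 \<le> real n * (y - x) then indicator {-c<..<c} t *\<^sub>R (g t * \<eta> n t) else 0))
        = (LINT t|lborel. indicator {-c<..<c} t *\<^sub>R (g t * \<eta> n t))"
        using ev[OF yx, of 4] xy by (auto elim!: eventually_mono)
      have gm: "(\<lambda>t. indicator {-c<..<c} t *\<^sub>R g t) \<in> borel_measurable lborel"
        using gi unfolding set_integrable_def by auto
      have "(\<lambda>t. indicator {x<..<y} t * (indicator {-c<..<c} t *\<^sub>R g t)) \<in> borel_measurable lborel"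
        by (intro borel_measurable_times gm) auto
      then show "(\<lambda>t. indicator {x<..<y} t *\<^sub>R g t) \<in> borel_measurable lborel"
        by (rule measurable_cong[THEN iffD1, rotated]) (use xy in \<open>auto split: split_indicator\<close>)
      have "continuous_on UNIV (\<eta> n)" for n
        using D by (meson DERIV_isCont continuous_at_imp_continuous_on)
      then have "\<eta> n \<in> borel_measurable lborel" for n
        by (simp add: borel_measurable_continuous_onI)
      then have "(\<lambda>t. (indicator {-c<..<c} t *\<^sub>R g t) * \<eta> n t) \<in> borel_measurable lborel" for n
        by (intro borel_measurable_times gm)
      then show "(\<lambda>t. if 4 \<le> real n * (y - x) then indicator {-c<..<c} t *\<^sub>R (g t * \<eta> n t) else 0) \<in> borel_measurable lborel" for n
        by (cases "4 \<le> real n * (y - x)") (auto simp: mult.assoc)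
      show "integrable lborel (\<lambda>t. \<bar>indicator {-c<..<c} t *\<^sub>R g t\<bar>)"
        using gi unfolding set_integrable_def by (rule integrable_abs)
      show "AE t in lborel. norm (if 4 \<le> real n * (y - x) then indicator {-c<..<c} t *\<^sub>R (g t * \<eta> n t) else 0)
        \<le> \<bar>indicator {-c<..<c} t *\<^sub>R g t\<bar>" for n
      proof (rule AE_I2)
        fix t
        have "\<bar>\<eta> n t\<bar> \<le> 1" unfolding \<eta>_def
          using smooth_step_bounds[of "real n * t + (- real n * x - 1)"] smooth_step_bounds[of "real n * t + (2 - real n * y)"]
          by linarith
        then have "\<bar>g t\<bar> * \<bar>\<eta> n t\<bar> \<le> \<bar>g t\<bar> * 1" by (intro mult_left_mono) auto
        then show "norm (if 4 \<le> real n * (y - x) then indicator {-c<..<c} t *\<^sub>R (g t * \<eta> n t) else 0)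
        \<le> \<bar>indicator {-c<..<c} t *\<^sub>R g t\<bar>" by (auto simp: abs_mult split: split_indicator)
      qed
      show "AE t in lborel. (\<lambda>n. if 4 \<le> real n * (y - x) then indicator {-c<..<c} t *\<^sub>R (g t * \<eta> n t) else 0)
         \<longlonglongrightarrow> indicator {x<..<y} t *\<^sub>R g t"
      proof (rule AE_I2)
        fix t
        consider "t \<le> x" | "x < t" "t < y" | "y \<le> t" by linarith
        then have "\<forall>\<^sub>F n in sequentially. \<eta> n t = indicator {x<..<y} t"
        proof cases
          case 1
          show ?thesis using ev[OF yx, of 4]
          proof (eventually_elim)
            case (elim n)
            have "real n * t \<le> real n * x" using 1 by (intro mult_left_mono) auto
            then show ?case using 1 elim xy by (simp add: \<eta>_def smooth_step_eq_0 algebra_simps)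
          qed
        next
          case 2
          then have "t - x > 0" "y - t > 0" by auto
          from ev[OF this(1), of 2] ev[OF this(2), of 2] show ?thesis
          proof (eventually_elim)
            case (elim n)
            then show ?case using 2 xy by (simp add: \<eta>_def smooth_step_eq_0 smooth_step_eq_1 algebra_simps)
          qed
        next
          case 3
          show ?thesis using ev[OF yx, of 4]
          proof (eventually_elim)
            case (elim n)
            have "real n * t \<ge> real n * y" using 3 by (intro mult_left_mono) auto
            then show ?case using 3 elim xy by (simp add: \<eta>_def smooth_step_eq_1 algebra_simps)
          qed
        qed
        then have "\<forall>\<^sub>F n in sequentially. (if 4 \<le> real n * (y - x) then indicator {-c<..<c} t *\<^sub>R (g t * \<eta> n t) else 0)
           = indicator {x<..<y} t *\<^sub>R g t"
          using ev[OF yx, of 4]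
        proof (eventually_elim)
          case (elim n)
          then show ?case using xy by (auto split: split_indicator)
        qed
        then show "(\<lambda>n. if 4 \<le> real n * (y - x) then indicator {-c<..<c} t *\<^sub>R (g t * \<eta> n t) else 0)
         \<longlonglongrightarrow> indicator {x<..<y} t *\<^sub>R g t" by (rule tendsto_eventually)
      qed
    qed
    ultimately have "(\<lambda>n. (LBINT t:{-c<..<c}. u t * (K1 n t - K2 n t)) + (LBINT t:{-c<..<c}. g t * \<eta> n t))
       \<longlonglongrightarrow> (u x - u y) + (LBINT t:{x<..<y}. g t)" by (rule tendsto_add)
    moreover have "(\<lambda>n. (LBINT t:{-c<..<c}. u t * (K1 n t - K2 n t)) + (LBINT t:{-c<..<c}. g t * \<eta> n t)) \<longlonglongrightarrow> 0"
      by (rule tendsto_eventually, rule eventually_mono[OF ev[OF yx, of 4]]) (use xy test in auto)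
    ultimately have "(u x - u y) + (LBINT t:{x<..<y}. g t) = 0" by (rule LIMSEQ_unique)
    then show ?thesis by simp
  qed
  show ?thesis unfolding primitive_on_def
  proof (intro conjI gi allI impI)
    fix x y assume "- c \<le> x" "x \<le> y" "y \<le> c"
    then show "u y - u x = (LBINT t:{x<..<y}. g t)"
      using main[of x y] by (cases "x = y") (auto simp: set_lebesgue_integral_def)
  qed
qed

lemma continuous_imp_L2_on:
  assumes "continuous_on {a..b} u"
  shows "L2_on {a<..<b} u"
  unfolding L2_on_def
proof
  show "set_borel_measurable lborel {a<..<b} u"
    using continuous_imp_set_integrable_Ioo[OF assms] by (simp add: set_borel_measurable_def set_integrable_def)
  show "set_integrable lborel {a<..<b} (\<lambda>x. (u x)\<^sup>2)"
    by (intro continuous_imp_set_integrable_Ioo continuous_intros assms)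
qed

lemma C1_is_weak_deriv:
  assumes c: "c > 0"
    and w: "\<And>x. -c \<le> x \<Longrightarrow> x \<le> c \<Longrightarrow> (w has_real_derivative w' x) (at x)" "continuous_on {-c..c} w'"
  shows "is_weak_deriv c w w'"
  unfolding is_weak_deriv_def
proof (intro conjI allI impI)
  show "L2_on {-c<..<c} w'" by (rule continuous_imp_L2_on[OF w(2)])
  fix \<eta> assume "C1c_on {-c<..<c} \<eta>"
  then obtain D C where D: "\<And>x. (\<eta> has_vector_derivative D x) (at x)" "continuous_on UNIV D"
    and C: "C \<subseteq> {-c<..<c}" "\<And>x. x \<notin> C \<Longrightarrow> \<eta> x = 0"
    unfolding C1c_on_def C1_differentiable_on_def by auto
  have d: "(\<eta> has_real_derivative D x) (at x)" for x
    using D(1) by (simp add: has_real_derivative_iff_has_vector_derivative)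
  have cw: "continuous_on {-c..c} w" using w(1) by (meson DERIV_isCont atLeastAtMost_iff continuous_at_imp_continuous_on)
  have ceta: "continuous_on {-c..c} \<eta>" using d by (meson DERIV_isCont continuous_at_imp_continuous_on)
  have cD: "continuous_on {-c..c} D" using D(2) continuous_on_subset by blast
  have "primitive_on (-c) c (\<lambda>x. w x * \<eta> x) (\<lambda>x. w' x * \<eta> x + D x * w x)"
    by (intro primitive_on_mult C1_imp_primitive_on w d cw ceta cD)
  then have "w c * \<eta> c - w (-c) * \<eta> (-c) = (LBINT t:{-c<..<c}. w' t * \<eta> t + D t * w t)"
    unfolding primitive_on_def using c by auto
  also have "\<dots> = (LBINT t:{-c<..<c}. w' t * \<eta> t) + (LBINT t:{-c<..<c}. D t * w t)"
    by (intro set_integral_add continuous_imp_set_integrable_Ioo continuous_on_mult w cw ceta cD)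
  moreover have "\<eta> c = 0" by (rule C(2)) (use C(1) in auto)
  moreover have "\<eta> (-c) = 0" by (rule C(2)) (use C(1) in auto)
  moreover have "deriv \<eta> = D" using d DERIV_imp_deriv by blast
  ultimately show "(LBINT x:{-c<..<c}. w x * deriv \<eta> x) = - (LBINT x:{-c<..<c}. w' x * \<eta> x)"
    by (simp add: mult.commute)
qed

lemma set_borel_measurable_mult:
  fixes f g :: "real \<Rightarrow> real"
  assumes "set_borel_measurable lborel I f" "set_borel_measurable lborel I g"
  shows "set_borel_measurable lborel I (\<lambda>x. f x * g x)"
proof -
  have "(\<lambda>x. (indicator I x *\<^sub>R f x) * (indicator I x *\<^sub>R g x)) \<in> borel_measurable lborel"
    using assms unfolding set_borel_measurable_def by (rule borel_measurable_times)
  then show ?thesis unfolding set_borel_measurable_def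
    by (rule measurable_cong[THEN iffD1, rotated]) (auto split: split_indicator)
qed

lemma set_borel_measurable_diff:
  fixes f g :: "real \<Rightarrow> real"
  assumes "set_borel_measurable lborel I f" "set_borel_measurable lborel I g"
  shows "set_borel_measurable lborel I (\<lambda>x. f x - g x)"
  using borel_measurable_diff[OF assms[unfolded set_borel_measurable_def]]
  by (simp add: set_borel_measurable_def algebra_simps)

text \<open>
  The difference of two densities has vanishing integral over all intervals, hence by the
  \<open>\<pi>\<close>-\<open>\<lambda>\<close> theorem over all Borel sets.
\<close>
lemma primitive_on_AE_unique:
  assumes ab: "a \<le> b" and 1: "primitive_on a b u g" and 2: "primitive_on a b u h"
  shows "AE x in lborel. x \<in> {a<..<b} \<longrightarrow> g x = h x"
proof -
  define k where "k = (\<lambda>x. indicator {a<..<b} x *\<^sub>R (g x - h x))"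
  have gi: "set_integrable lborel {a<..<b} g" and hi: "set_integrable lborel {a<..<b} h"
    using 1 2 by (auto simp: primitive_on_def)
  have ki: "integrable lborel k"
    using set_integral_diff(1)[OF gi hi] by (simp add: k_def set_integrable_def)
  have sub: "set_integrable lborel {x<..<y} f" if "set_integrable lborel {a<..<b} f" "a \<le> x" "y \<le> b"
    for f :: "real \<Rightarrow> real" and x y
    by (rule set_integrable_subset[OF that(1)]) (use that in auto)
  have int0: "(LBINT x:{p<..<q}. g x - h x) = 0" if "a \<le> p" "q \<le> b" for p q
  proof (cases "p \<le> q")
    case True
    have "(LBINT x:{p<..<q}. g x - h x) = (LBINT x:{p<..<q}. g x) - (LBINT x:{p<..<q}. h x)"
      by (rule set_integral_diff(2)) (use sub gi hi that in auto)
    then show ?thesis using 1 2 that True unfolding primitive_on_def by simp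
  qed (simp add: set_lebesgue_integral_def)
  have Ioo: "(LINT x|lborel. indicator {p<..<q} x *\<^sub>R k x) = 0" for p q
  proof -
    have "indicator {p<..<q} x *\<^sub>R k x = indicator {max p a<..<min q b} x *\<^sub>R (g x - h x)" for x
      by (auto simp: k_def split: split_indicator)
    then show ?thesis using int0[of "max p a" "min q b"] by (simp add: set_lebesgue_integral_def)
  qed
  have tot: "(LINT x|lborel. k x) = 0"
    using int0[of a b] ab by (simp add: k_def set_lebesgue_integral_def)
  have mi: "integrable lborel (\<lambda>x. indicator A x *\<^sub>R k x)" if "A \<in> sets borel" for A
    using integrable_mult_indicator[OF _ ki, of A] that by simp
  have borel: "borel = sigma UNIV (range (\<lambda>(a,b). {a<..<b::real}))"
    using borel_eq_box[where 'a=real] by simp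
  have borelI: "A \<in> sets borel" if "A \<in> sigma_sets UNIV (range (\<lambda>(a,b). {a<..<b::real}))" for A
    using that by (subst borel) (simp add: sets_measure_of)
  have all: "(LINT x|lborel. indicator A x *\<^sub>R k x) = 0" if "A \<in> sets borel" for A
  proof -
    have A: "A \<in> sigma_sets UNIV (range (\<lambda>(a,b). {a<..<b::real}))"
      using that by (subst (asm) borel) (simp add: sets_measure_of)
    have "Int_stable (range (\<lambda>(a,b). {a<..<b::real}))"
      by (auto simp: Int_stable_def)
    moreover have "range (\<lambda>(a,b). {a<..<b::real}) \<subseteq> Pow UNIV" by simp
    ultimately show ?thesis using A
    proof (induction rule: sigma_sets_induct_disjoint)
      case (basic A) then show ?case using Ioo by auto
    next
      case empty then show ?case by simp
    next
      case (compl A)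
      then have "A \<in> sets borel" using borelI by blast
      have "(LINT x|lborel. indicator (UNIV - A) x *\<^sub>R k x) = (LINT x|lborel. k x - indicator A x *\<^sub>R k x)"
        by (rule Bochner_Integration.integral_cong) (auto split: split_indicator)
      also have "\<dots> = 0" using tot compl.IH mi[OF \<open>A \<in> sets borel\<close>] ki by (subst Bochner_Integration.integral_diff) auto
      finally show ?case .
    next
      case (union A)
      then have A: "A i \<in> sets borel" for i using borelI by blast
      have "(LINT x:(\<Union>i. A i)|lborel. k x) = (\<Sum>i. (LINT x:(A i)|lborel. k x))"
        by (rule lebesgue_integral_countable_add)
           (use A union mi[of "\<Union>i. A i"] in \<open>auto simp: disjoint_family_on_def set_integrable_def\<close>)
      then show ?case using union by (simp add: set_lebesgue_integral_def)
    qed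
  qed
  have "AE x in lborel. k x = 0"
    by (rule density_unique_real[OF ki]) (use all in \<open>auto simp: set_lebesgue_integral_def\<close>)
  then show ?thesis by eventually_elim (auto simp: k_def)
qed

section \<open>Linear systems of two first-order equations\<close>

lemma DERIV_LBINT_0:
  fixes f :: "real \<Rightarrow> real"
  assumes "continuous_on UNIV f"
  shows "((\<lambda>x. LBINT t=0..x. f t) has_real_derivative f x) (at x)"
proof -
  have "((\<lambda>u. LBINT t=ereal 0..ereal u. f t) has_vector_derivative f x) (at x within {-\<bar>x\<bar>-1..\<bar>x\<bar>+1})"
    by (rule interval_integral_FTC2) (use assms continuous_on_subset in auto)
  moreover have "x \<in> interior {-\<bar>x\<bar>-1..\<bar>x\<bar>+1}" by simp linarith
  ultimately have "((\<lambda>u. LBINT t=ereal 0..ereal u. f t) has_vector_derivative f x) (at x)"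
    by (simp only: at_within_interior)
  then show ?thesis
    by (simp only: has_real_derivative_iff_has_vector_derivative zero_ereal_def)
qed

lemma abs_le_power_of_DERIV_le:
  fixes F f :: "real \<Rightarrow> real"
  assumes d: "\<And>x. (F has_real_derivative f x) (at x)" and F0: "F 0 = 0"
    and le: "\<And>t. \<bar>t\<bar> \<le> R \<Longrightarrow> \<bar>f t\<bar> \<le> C * \<bar>t\<bar> ^ n" and x: "\<bar>x\<bar> \<le> R"
  shows "\<bar>F x\<bar> \<le> C * \<bar>x\<bar> ^ Suc n / real (Suc n)"
proof -
  have upper: "F x \<le> C * x ^ Suc n / real (Suc n)"
    if d: "\<And>x. (F has_real_derivative f x) (at x)" and F0: "F 0 = 0"
    and le: "\<And>t. 0 \<le> t \<Longrightarrow> t \<le> R \<Longrightarrow> f t \<le> C * t ^ n" and x: "0 \<le> x" "x \<le> R" for F f and x :: real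
  proof -
    have "C * 0 ^ Suc n / real (Suc n) - F 0 \<le> C * x ^ Suc n / real (Suc n) - F x"
    proof (rule DERIV_nonneg_imp_nondecreasing[OF x(1)])
      fix t assume t: "0 \<le> t" "t \<le> x"
      have "((\<lambda>t. C * t ^ Suc n / real (Suc n) - F t) has_real_derivative (C * t ^ n - f t)) (at t)"
      proof -
        have "((\<lambda>t. C * t ^ Suc n / real (Suc n) - F t) has_real_derivative
           (C * (real (Suc n) * t ^ n) / real (Suc n) - f t)) (at t)"
          by (intro DERIV_diff d DERIV_cdivide DERIV_cmult) (use DERIV_pow[of "Suc n" t] in simp)
        then show ?thesis by (simp del: of_nat_Suc)
      qed
      then show "\<exists>y. ((\<lambda>t. C * t ^ Suc n / real (Suc n) - F t) has_real_derivative y) (at t) \<and> 0 \<le> y"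
        using le[of t] t x by force
    qed
    then show ?thesis using F0 by simp
  qed
  have both: "\<bar>F x\<bar> \<le> C * x ^ Suc n / real (Suc n)"
    if d: "\<And>x. (F has_real_derivative f x) (at x)" and F0: "F 0 = 0"
    and le: "\<And>t. 0 \<le> t \<Longrightarrow> t \<le> R \<Longrightarrow> \<bar>f t\<bar> \<le> C * t ^ n" and x: "0 \<le> x" "x \<le> R" for F f and x :: real
  proof -
    have "F x \<le> C * x ^ Suc n / real (Suc n)"
      by (rule upper[OF d F0]) (use le x in \<open>auto simp: abs_le_iff\<close>)
    moreover have "- F x \<le> C * x ^ Suc n / real (Suc n)"
    proof (rule upper[of "\<lambda>x. - F x" "\<lambda>x. - f x"])
      show "((\<lambda>x. - F x) has_real_derivative - f x) (at x)" for x by (rule DERIV_minus[OF d])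
    qed (use le x F0 in \<open>auto simp: abs_le_iff\<close>)
    ultimately show ?thesis by linarith
  qed
  show ?thesis
  proof (cases "x \<ge> 0")
    case True
    have "\<bar>F x\<bar> \<le> C * x ^ Suc n / real (Suc n)"
    proof (rule both[OF d F0 _ True])
      fix t :: real assume "0 \<le> t" "t \<le> R"
      then show "\<bar>f t\<bar> \<le> C * t ^ n" using le[of t] by simp
    qed (use x in simp)
    then show ?thesis using True by simp
  next
    case False
    have "((\<lambda>x. F (- x)) has_real_derivative - f (- x)) (at x)" for x
    proof -
      have "((\<lambda>x::real. - x) has_real_derivative - 1) (at x)" by (auto intro!: derivative_eq_intros)
      from DERIV_chain2[OF d this] show ?thesis by simp
    qed
    then have "\<bar>F (-(-x))\<bar> \<le> C * (-x) ^ Suc n / real (Suc n)"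
    proof (rule both[of "\<lambda>x. F (- x)" "\<lambda>x. - f (- x)" "-x"])
      fix t :: real assume "0 \<le> t" "t \<le> R"
      then show "\<bar>- f (- t)\<bar> \<le> C * t ^ n" using le[of "-t"] by simp
    qed (use F0 x False in simp_all)
    then show ?thesis using False by simp
  qed
qed

text \<open>
  The \<open>n\<close>-th term of the Picard series for \<open>w' = \<alpha> p\<close>, \<open>p' = \<beta> w\<close> with \<open>(w, p)(0) = (1, 0)\<close>.
\<close>
primrec picard :: "(real \<Rightarrow> real) \<Rightarrow> (real \<Rightarrow> real) \<Rightarrow> nat \<Rightarrow> (real \<Rightarrow> real) \<times> (real \<Rightarrow> real)" where
  "picard \<alpha> \<beta> 0 = (\<lambda>_. 1, \<lambda>_. 0)"
| "picard \<alpha> \<beta> (Suc n) =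
    (\<lambda>x. LBINT t=0..x. \<alpha> t * snd (picard \<alpha> \<beta> n) t, \<lambda>x. LBINT t=0..x. \<beta> t * fst (picard \<alpha> \<beta> n) t)"

lemma DERIV_suminf_of_iterates:
  fixes f h :: "nat \<Rightarrow> real \<Rightarrow> real"
  assumes d0: "\<And>x. (f 0 has_real_derivative 0) (at x)"
    and d: "\<And>n x. (f (Suc n) has_real_derivative \<alpha> x * h n x) (at x)"
    and fb: "\<And>n x. \<bar>x\<bar> \<le> R \<Longrightarrow> \<bar>f n x\<bar> \<le> M ^ n / fact n"
    and hb: "\<And>n x. \<bar>x\<bar> \<le> R \<Longrightarrow> \<bar>h n x\<bar> \<le> M ^ n / fact n"
    and \<alpha>: "\<And>x. \<bar>x\<bar> \<le> R \<Longrightarrow> \<bar>\<alpha> x\<bar> \<le> L" and x: "\<bar>x\<bar> < R"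
  shows "((\<lambda>x. \<Sum>n. f n x) has_real_derivative \<alpha> x * (\<Sum>n. h n x)) (at x)"
proof -
  define f' where "f' n x = (case n of 0 \<Rightarrow> 0 | Suc m \<Rightarrow> \<alpha> x * h m x)" for n x
  define K where "K n = (case n of 0 \<Rightarrow> 0 | Suc m \<Rightarrow> L * (M ^ m / fact m))" for n
  have sexp: "summable (\<lambda>n. M ^ n / fact n)"
    using summable_exp[of M] by (simp add: field_simps)
  have L: "L \<ge> 0" using \<alpha>[of x] x by linarith
  have sK: "summable K"
    using summable_mult[OF sexp, of L] by (subst summable_Suc_iff[symmetric]) (simp add: K_def)
  have bd: "norm (f' n y) \<le> K n" if "y \<in> {-R..R}" for n y
  proof (cases n)
    case (Suc m)
    have "\<bar>\<alpha> y\<bar> * \<bar>h m y\<bar> \<le> L * (M ^ m / fact m)"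
      using \<alpha>[of y] hb[of y m] that L by (intro mult_mono) auto
    then show ?thesis using Suc by (simp add: f'_def K_def abs_mult)
  qed (simp add: f'_def K_def)
  have sumfh: "summable (\<lambda>n. h n x)"
    by (rule summable_comparison_test'[OF sexp, of 0]) (use hb x in auto)
  have "((\<lambda>x. \<Sum>n. f n x) has_real_derivative (\<Sum>n. f' n x)) (at x)"
  proof (rule has_field_derivative_series'(2)[where S="{-R..R}" and x0=x])
    show "(f n has_real_derivative f' n y) (at y within {-R..R})" for n y
      by (cases n) (auto simp: f'_def intro: has_field_derivative_at_within d0 d)
    show "uniformly_convergent_on {-R..R} (\<lambda>n x. \<Sum>i<n. f' i x)"
      by (rule Weierstrass_m_test'[OF bd sK])
    show "summable (\<lambda>n. f n x)"
      by (rule summable_comparison_test'[OF sexp, of 0]) (use fb x in auto)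
  qed (use x in auto)
  also have "(\<Sum>n. f' n x) = (\<Sum>n. f' (Suc n) x)"
  proof -
    have "summable (\<lambda>n. f' n x)" by (rule summable_comparison_test'[OF sK, of 0]) (rule bd, use x in auto)
    from suminf_split_head[OF this] show ?thesis by (simp add: f'_def)
  qed
  also have "\<dots> = \<alpha> x * (\<Sum>n. h n x)" using sumfh by (simp add: f'_def suminf_mult)
  finally show ?thesis .
qed

text \<open>
  If \<open>L\<close> bounds both coefficients, the \<open>n\<close>-th Picard term is at most \<open>(L |x|)\<^sup>n / n!\<close>; so the series
  and its termwise derivative converge uniformly.
\<close>
lemma linear_system_solution:
  fixes \<alpha> \<beta> :: "real \<Rightarrow> real"
  assumes c\<alpha>: "continuous_on UNIV \<alpha>" and c\<beta>: "continuous_on UNIV \<beta>" and R: "R > 0"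
  shows "\<exists>w p. w 0 = 1 \<and> p 0 = 0 \<and> (\<forall>x. \<bar>x\<bar> < R \<longrightarrow>
    (w has_real_derivative \<alpha> x * p x) (at x) \<and> (p has_real_derivative \<beta> x * w x) (at x))"
proof -
  define f where "f n = fst (picard \<alpha> \<beta> n)" for n
  define h where "h n = snd (picard \<alpha> \<beta> n)" for n
  have "\<exists>C. \<forall>x\<in>{-R..R}. norm (k x) \<le> C" if "continuous_on UNIV k" for k :: "real \<Rightarrow> real"
  proof -
    have "compact (k ` {-R..R})" using that by (intro compact_continuous_image) (auto intro: continuous_on_subset)
    then have "bounded (k ` {-R..R})" by (rule compact_imp_bounded)
    then show ?thesis unfolding bounded_iff by blast
  qed
  from this[OF c\<alpha>] this[OF c\<beta>] obtain C1 C2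
    where C: "\<forall>x\<in>{-R..R}. norm (\<alpha> x) \<le> C1" "\<forall>x\<in>{-R..R}. norm (\<beta> x) \<le> C2"
    by blast
  define L where "L = max C1 C2"
  have L: "\<bar>\<alpha> x\<bar> \<le> L" "\<bar>\<beta> x\<bar> \<le> L" if "\<bar>x\<bar> \<le> R" for x
    using C[THEN bspec, of x] that by (simp_all add: L_def abs_le_iff le_max_iff_disj)
  have L0: "L \<ge> 0" using L(1)[of 0] R by auto
  have cont: "continuous_on UNIV (f n) \<and> continuous_on UNIV (h n)" for n
  proof (induction n)
    case 0 then show ?case by (simp add: f_def h_def)
  next
    case (Suc n)
    have "continuous_on UNIV (\<lambda>t. \<alpha> t * h n t)" "continuous_on UNIV (\<lambda>t. \<beta> t * f n t)"
      using Suc c\<alpha> c\<beta> by (auto intro: continuous_on_mult)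
    from DERIV_LBINT_0[OF this(1)] DERIV_LBINT_0[OF this(2)] show ?case
      unfolding f_def h_def by (simp, meson DERIV_isCont continuous_at_imp_continuous_on)
  qed
  have d: "(f (Suc n) has_real_derivative \<alpha> x * h n x) (at x)" "(h (Suc n) has_real_derivative \<beta> x * f n x) (at x)" for n x
  proof -
    have "continuous_on UNIV (\<lambda>t. \<alpha> t * h n t)" "continuous_on UNIV (\<lambda>t. \<beta> t * f n t)"
      using cont c\<alpha> c\<beta> by (auto intro: continuous_on_mult)
    from DERIV_LBINT_0[OF this(1)] DERIV_LBINT_0[OF this(2)]
    show "(f (Suc n) has_real_derivative \<alpha> x * h n x) (at x)" "(h (Suc n) has_real_derivative \<beta> x * f n x) (at x)"
      unfolding f_def h_def by simp_all
  qed
  have at0: "f (Suc n) 0 = 0" "h (Suc n) 0 = 0" for n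
    by (simp_all add: f_def h_def flip: zero_ereal_def)
  have bd: "\<bar>x\<bar> \<le> R \<Longrightarrow> \<bar>f n x\<bar> \<le> L ^ n * \<bar>x\<bar> ^ n / fact n \<and> \<bar>h n x\<bar> \<le> L ^ n * \<bar>x\<bar> ^ n / fact n" for n x
  proof (induction n arbitrary: x)
    case 0 then show ?case by (simp add: f_def h_def)
  next
    case (Suc n)
    have "\<bar>\<alpha> t * h n t\<bar> \<le> (L ^ Suc n / fact n) * \<bar>t\<bar> ^ n" if "\<bar>t\<bar> \<le> R" for t
    proof -
      have "\<bar>\<alpha> t\<bar> * \<bar>h n t\<bar> \<le> L * (L ^ n * \<bar>t\<bar> ^ n / fact n)"
        using L(1)[OF that] Suc.IH[OF that] L0 by (intro mult_mono) auto
      then show ?thesis by (simp add: abs_mult)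
    qed
    from abs_le_power_of_DERIV_le[OF d(1) at0(1) this Suc.prems]
    have 1: "\<bar>f (Suc n) x\<bar> \<le> L ^ Suc n / fact n * \<bar>x\<bar> ^ Suc n / real (Suc n)" .
    have "\<bar>\<beta> t * f n t\<bar> \<le> (L ^ Suc n / fact n) * \<bar>t\<bar> ^ n" if "\<bar>t\<bar> \<le> R" for t
    proof -
      have "\<bar>\<beta> t\<bar> * \<bar>f n t\<bar> \<le> L * (L ^ n * \<bar>t\<bar> ^ n / fact n)"
        using L(2)[OF that] Suc.IH[OF that] L0 by (intro mult_mono) auto
      then show ?thesis by (simp add: abs_mult)
    qed
    from abs_le_power_of_DERIV_le[OF d(2) at0(2) this Suc.prems]
    have 2: "\<bar>h (Suc n) x\<bar> \<le> L ^ Suc n / fact n * \<bar>x\<bar> ^ Suc n / real (Suc n)" .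
    have "L ^ Suc n / fact n * \<bar>x\<bar> ^ Suc n / real (Suc n) = L ^ Suc n * \<bar>x\<bar> ^ Suc n / fact (Suc n)"
      by (simp add: fact_Suc field_simps)
    then show ?case using 1 2 by metis
  qed
  have le: "L ^ n * \<bar>x\<bar> ^ n / fact n \<le> (L * R) ^ n / fact n" if "\<bar>x\<bar> \<le> R" for n x
    using that L0 by (auto simp: power_mult_distrib intro!: divide_right_mono mult_left_mono power_mono)
  have fb: "\<bar>f n x\<bar> \<le> (L * R) ^ n / fact n" and hb: "\<bar>h n x\<bar> \<le> (L * R) ^ n / fact n" if "\<bar>x\<bar> \<le> R" for n x
    using bd[OF that, of n] le[OF that, of n] by linarith+
  have d0: "(f 0 has_real_derivative 0) (at x)" "(h 0 has_real_derivative 0) (at x)" for x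
    by (simp_all add: f_def h_def)
  show ?thesis
  proof (rule exI[of _ "\<lambda>x. \<Sum>n. f n x"], rule exI[of _ "\<lambda>x. \<Sum>n. h n x"], intro conjI allI impI)
    have "(\<Sum>n. f n 0) = (\<Sum>n\<in>{0}. f n 0)"
      by (rule suminf_finite) (auto simp: at0 gr0_conv_Suc dest!: not0_implies_Suc)
    then show "(\<Sum>n. f n 0) = 1" by (simp add: f_def)
    have "h n 0 = 0" for n by (cases n) (auto simp: at0, simp add: h_def)
    then show "(\<Sum>n. h n 0) = 0" by simp
    fix x assume x: "\<bar>x\<bar> < R"
    show "((\<lambda>x. \<Sum>n. f n x) has_real_derivative \<alpha> x * (\<Sum>n. h n x)) (at x)"
      by (rule DERIV_suminf_of_iterates[where f=f and h=h and \<alpha>=\<alpha> and M="L * R" and L=L and R=R, OF d0(1) d(1) fb hb L(1) x])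
    show "((\<lambda>x. \<Sum>n. h n x) has_real_derivative \<beta> x * (\<Sum>n. f n x)) (at x)"
      by (rule DERIV_suminf_of_iterates[where f=h and h=f and \<alpha>=\<beta> and M="L * R" and L=L and R=R, OF d0(2) d(2) hb fb L(2) x])
  qed
qed

lemma gronwall_upper:
  fixes E E' :: "real \<Rightarrow> real"
  assumes d: "\<And>x. 0 \<le> x \<Longrightarrow> x \<le> c \<Longrightarrow> (E has_real_derivative E' x) (at x)"
    and le: "\<And>x. 0 \<le> x \<Longrightarrow> x \<le> c \<Longrightarrow> E' x \<le> L * E x + K"
    and L: "L \<ge> 0" and K: "K \<ge> 0" and x: "0 \<le> x" "x \<le> c"
  shows "E x \<le> exp (L * x) * (E 0 + K * x)"
proof -
  have "exp (- L * x) * E x - K * x \<le> exp (- L * 0) * E 0 - K * 0"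
  proof (rule DERIV_nonpos_imp_nonincreasing[OF x(1)])
    fix t assume t: "0 \<le> t" "t \<le> x"
    have dE: "(E has_real_derivative E' t) (at t)" using d t x by simp
    have "((\<lambda>t. exp (- L * t) * E t - K * t) has_real_derivative
       (exp (- L * t) * (E' t - L * E t) - K)) (at t)"
      by (rule derivative_eq_intros dE refl)+ (simp add: algebra_simps)
    moreover have "exp (- L * t) * (E' t - L * E t) - K \<le> 0"
    proof -
      have "exp (- L * t) * (E' t - L * E t) \<le> exp (- L * t) * K"
        using le[of t] t x by (intro mult_left_mono) auto
      also have "\<dots> \<le> 1 * K" using L K t by (intro mult_right_mono) auto
      finally show ?thesis by simp
    qed
    ultimately show "\<exists>y. ((\<lambda>t. exp (- L * t) * E t - K * t) has_real_derivative y) (at t) \<and> y \<le> 0" by blast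
  qed
  then have "exp (- L * x) * E x \<le> E 0 + K * x" by simp
  then have "exp (L * x) * (exp (- L * x) * E x) \<le> exp (L * x) * (E 0 + K * x)" by (intro mult_left_mono) auto
  then show ?thesis by (simp add: mult.assoc[symmetric] exp_add[symmetric])
qed

lemma gronwall_lower:
  fixes E E' :: "real \<Rightarrow> real"
  assumes d: "\<And>x. 0 \<le> x \<Longrightarrow> x \<le> c \<Longrightarrow> (E has_real_derivative E' x) (at x)"
    and le: "\<And>x. 0 \<le> x \<Longrightarrow> x \<le> c \<Longrightarrow> - L * E x \<le> E' x" and x: "0 \<le> x" "x \<le> c"
  shows "exp (- L * x) * E 0 \<le> E x"
proof -
  have "exp (L * 0) * E 0 \<le> exp (L * x) * E x"
  proof (rule DERIV_nonneg_imp_nondecreasing[OF x(1)])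
    fix t assume t: "0 \<le> t" "t \<le> x"
    have dE: "(E has_real_derivative E' t) (at t)" using d t x by simp
    have "((\<lambda>t. exp (L * t) * E t) has_real_derivative (exp (L * t) * (E' t + L * E t))) (at t)"
      by (rule derivative_eq_intros dE refl)+ (simp add: algebra_simps)
    moreover have "exp (L * t) * (E' t + L * E t) \<ge> 0" using le[of t] t x by simp
    ultimately show "\<exists>y. ((\<lambda>t. exp (L * t) * E t) has_real_derivative y) (at t) \<and> 0 \<le> y" by blast
  qed
  then have "exp (- L * x) * E 0 \<le> exp (- L * x) * (exp (L * x) * E x)" by (intro mult_left_mono) auto
  then show ?thesis by (simp add: mult.assoc[symmetric] exp_add[symmetric])
qed

section \<open>An even Robin problem and its shooting solution\<close>

text \<open>
  The eigenvalue problem \<open>- (B w')' - V w = \<mu> B w\<close> on \<open>[-c, c]\<close> with Robin condition \<open>B w' = \<beta> w\<close> at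
  \<open>c\<close>, for even data and even functions. It is the Euler-Lagrange equation of
  \<open>\<integral> (B u'\<^sup>2 - V u\<^sup>2) - \<beta> (u(c)\<^sup>2 + u(-c)\<^sup>2)\<close> relative to \<open>\<integral> B u\<^sup>2\<close>.
\<close>
locale even_robin_problem =
  fixes B V :: "real \<Rightarrow> real" and c \<beta> :: real
  assumes continuous_B: "continuous_on UNIV B" and continuous_V: "continuous_on UNIV V"
    and B_pos: "B x > 0" and B_even: "B (- x) = B x" and V_even: "V (- x) = V x"
    and c_pos: "c > 0" and \<beta>_pos: "\<beta> > 0"
begin

text \<open>
  The equation as a first-order system for \<open>w\<close> and the flux \<open>p = B w'\<close>, started at the centre with
  even data. The margin beyond \<open>c\<close> makes the derivatives two-sided on \<open>[-c, c]\<close>.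
\<close>
definition is_sol :: "real \<Rightarrow> (real \<Rightarrow> real) \<Rightarrow> (real \<Rightarrow> real) \<Rightarrow> bool" where
  "is_sol \<mu> w p \<longleftrightarrow> w 0 = 1 \<and> p 0 = 0 \<and> (\<forall>x. \<bar>x\<bar> < c + 1 \<longrightarrow>
    (w has_real_derivative p x / B x) (at x) \<and>
    (p has_real_derivative - (V x + \<mu> * B x) * w x) (at x))"

definition sol :: "real \<Rightarrow> real \<Rightarrow> real" where "sol \<mu> = (SOME w. \<exists>p. is_sol \<mu> w p)"
definition flux :: "real \<Rightarrow> real \<Rightarrow> real" where "flux \<mu> = (SOME p. is_sol \<mu> (sol \<mu>) p)"

lemma is_sol_sol: "is_sol \<mu> (sol \<mu>) (flux \<mu>)"
proof -
  have 1: "continuous_on UNIV (\<lambda>x. 1 / B x)"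
    using B_pos by (intro continuous_intros continuous_B) (auto simp: less_imp_neq[symmetric])
  have 2: "continuous_on UNIV (\<lambda>x. - (V x + \<mu> * B x))"
    by (intro continuous_intros continuous_B continuous_V)
  have "\<exists>w p. is_sol \<mu> w p"
    using linear_system_solution[OF 1 2, of "c + 1"] c_pos by (simp add: is_sol_def)
  then have "\<exists>p. is_sol \<mu> (sol \<mu>) p" unfolding sol_def by (rule someI_ex)
  then show ?thesis unfolding flux_def by (rule someI_ex)
qed

lemma sol_0 [simp]: "sol \<mu> 0 = 1" and flux_0 [simp]: "flux \<mu> 0 = 0"
  using is_sol_sol by (auto simp: is_sol_def)

lemma DERIV_sol: "\<bar>x\<bar> \<le> c \<Longrightarrow> (sol \<mu> has_real_derivative flux \<mu> x / B x) (at x)"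
  and DERIV_flux: "\<bar>x\<bar> \<le> c \<Longrightarrow> (flux \<mu> has_real_derivative - (V x + \<mu> * B x) * sol \<mu> x) (at x)"
  using is_sol_sol by (auto simp: is_sol_def)

lemma continuous_on_sol: "continuous_on {-c..c} (sol \<mu>)"
  and continuous_on_flux: "continuous_on {-c..c} (flux \<mu>)"
proof -
  show "continuous_on {-c..c} (sol \<mu>)"
    by (intro continuous_at_imp_continuous_on ballI, rule DERIV_isCont[OF DERIV_sol]) auto
  show "continuous_on {-c..c} (flux \<mu>)"
    by (intro continuous_at_imp_continuous_on ballI, rule DERIV_isCont[OF DERIV_flux]) auto
qed

lemma continuous_bounded:
  assumes "continuous_on {-c..c} k"
  obtains C :: real where "C \<ge> 0" "\<And>x. \<bar>x\<bar> \<le> c \<Longrightarrow> \<bar>k x\<bar> \<le> C"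
proof -
  have "bounded (k ` {-c..c})" using assms by (intro compact_imp_bounded compact_continuous_image) auto
  then obtain C where C: "\<forall>x\<in>{-c..c}. norm (k x) \<le> C" unfolding bounded_iff by blast
  show ?thesis
  proof (rule that[of "max C 0"])
    fix x assume "\<bar>x\<bar> \<le> c"
    then have "x \<in> {-c..c}" by auto
    then have "\<bar>k x\<bar> \<le> C" using C by auto
    then show "\<bar>k x\<bar> \<le> max C 0" by simp
  qed simp
qed

lemma coefficient_bound:
  obtains L where "L \<ge> 0" "\<And>x \<mu>. \<bar>x\<bar> \<le> c \<Longrightarrow> \<bar>\<mu>\<bar> \<le> M \<Longrightarrow> \<bar>1 / B x - (V x + \<mu> * B x)\<bar> \<le> L"
proof -
  have "continuous_on {-c..c} (\<lambda>x. 1 / B x)" "continuous_on {-c..c} V" "continuous_on {-c..c} B"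
    using B_pos by (auto intro!: continuous_intros continuous_on_subset[OF continuous_B] continuous_on_subset[OF continuous_V]
      simp: less_imp_neq[symmetric])
  from this[THEN continuous_bounded] obtain C1 C2 C3 where C: "C1 \<ge> 0" "C2 \<ge> 0" "C3 \<ge> 0"
    "\<And>x. \<bar>x\<bar> \<le> c \<Longrightarrow> \<bar>1 / B x\<bar> \<le> C1" "\<And>x. \<bar>x\<bar> \<le> c \<Longrightarrow> \<bar>V x\<bar> \<le> C2" "\<And>x. \<bar>x\<bar> \<le> c \<Longrightarrow> \<bar>B x\<bar> \<le> C3"
    by metis
  show ?thesis
  proof (rule that[of "C1 + C2 + \<bar>M\<bar> * C3"])
    show "C1 + C2 + \<bar>M\<bar> * C3 \<ge> 0" using C by simp
    fix x \<mu> assume x: "\<bar>x\<bar> \<le> c" "\<bar>\<mu>\<bar> \<le> M"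
    have "\<bar>\<mu> * B x\<bar> \<le> \<bar>M\<bar> * C3" unfolding abs_mult using C x by (intro mult_mono) auto
    then show "\<bar>1 / B x - (V x + \<mu> * B x)\<bar> \<le> C1 + C2 + \<bar>M\<bar> * C3"
      using C(4,5)[OF x(1)] by linarith
  qed
qed

lemma abs_two_mult_le_sum_squares: "\<bar>k\<bar> \<le> L \<Longrightarrow> \<bar>2 * k * d * e\<bar> \<le> L * (d\<^sup>2 + e\<^sup>2)" for k d e L :: real
proof -
  assume k: "\<bar>k\<bar> \<le> L"
  have "\<bar>2 * k * d * e\<bar> = \<bar>k\<bar> * (2 * \<bar>d\<bar> * \<bar>e\<bar>)" by (simp add: abs_mult)
  also have "\<dots> \<le> L * (d\<^sup>2 + e\<^sup>2)"
    using k sum_squares_bound[of "\<bar>d\<bar>" "\<bar>e\<bar>"] by (intro mult_mono) auto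
  finally show ?thesis .
qed

text \<open>
  Energy method: \<open>d\<^sup>2 + e\<^sup>2\<close> has derivative \<open>2 (1/B - (V + \<mu> B)) d e\<close>, which is at most a constant
  times \<open>d\<^sup>2 + e\<^sup>2\<close> itself.
\<close>
lemma system_unique:
  assumes "\<And>x. 0 \<le> x \<Longrightarrow> x \<le> c \<Longrightarrow> (d has_real_derivative e x / B x) (at x)"
    and "\<And>x. 0 \<le> x \<Longrightarrow> x \<le> c \<Longrightarrow> (e has_real_derivative - (V x + \<mu> * B x) * d x) (at x)"
    and "d 0 = 0" "e 0 = 0" "0 \<le> x" "x \<le> c"
  shows "d x = 0 \<and> e x = 0"
proof -
  obtain L where L: "L \<ge> 0" "\<And>x \<mu>'. \<bar>x\<bar> \<le> c \<Longrightarrow> \<bar>\<mu>'\<bar> \<le> \<bar>\<mu>\<bar> \<Longrightarrow> \<bar>1 / B x - (V x + \<mu>' * B x)\<bar> \<le> L"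
    using coefficient_bound[of "\<bar>\<mu>\<bar>"] by blast
  have "(d x)\<^sup>2 + (e x)\<^sup>2 \<le> exp (L * x) * (((d 0)\<^sup>2 + (e 0)\<^sup>2) + 0 * x)"
  proof (rule gronwall_upper[OF _ _ L(1) order_refl assms(5,6)])
    fix t assume t: "0 \<le> t" "t \<le> c"
    show "((\<lambda>t. (d t)\<^sup>2 + (e t)\<^sup>2) has_real_derivative 2 * (1 / B t - (V t + \<mu> * B t)) * d t * e t) (at t)"
      by (rule derivative_eq_intros assms(1)[OF t] assms(2)[OF t] refl)+ (simp add: algebra_simps)
    show "2 * (1 / B t - (V t + \<mu> * B t)) * d t * e t \<le> L * ((d t)\<^sup>2 + (e t)\<^sup>2) + 0"
      using abs_two_mult_le_sum_squares[OF L(2)[of t \<mu>], of "d t" "e t"] t by (auto simp: abs_le_iff)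
  qed
  then have "(d x)\<^sup>2 + (e x)\<^sup>2 \<le> 0" using assms by simp
  then show ?thesis by (simp add: sum_power2_le_zero_iff)
qed

lemma sol_even: "\<bar>x\<bar> \<le> c \<Longrightarrow> sol \<mu> (- x) = sol \<mu> x"
  and flux_odd: "\<bar>x\<bar> \<le> c \<Longrightarrow> flux \<mu> (- x) = - flux \<mu> x"
proof -
  have neg: "((\<lambda>x. f (- x)) has_real_derivative - D) (at x)" if "(f has_real_derivative D) (at (- x))" for f D and x :: real
  proof -
    have "((\<lambda>x::real. - x) has_real_derivative - 1) (at x)" by (auto intro!: derivative_eq_intros)
    from DERIV_chain2[OF that this] show ?thesis by simp
  qed
  have *: "sol \<mu> x - sol \<mu> (- x) = 0 \<and> flux \<mu> x + flux \<mu> (- x) = 0" if "0 \<le> x" "x \<le> c" for x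
  proof (rule system_unique[OF _ _ _ _ that])
    fix x assume "0 \<le> x" "x \<le> c"
    then have x: "\<bar>x\<bar> \<le> c" "\<bar>-x\<bar> \<le> c" by auto
    show "((\<lambda>x. sol \<mu> x - sol \<mu> (- x)) has_real_derivative (flux \<mu> x + flux \<mu> (- x)) / B x) (at x)"
      using DERIV_diff[OF DERIV_sol[OF x(1)] neg[OF DERIV_sol[OF x(2)]]] by (simp add: B_even add_divide_distrib)
    show "((\<lambda>x. flux \<mu> x + flux \<mu> (- x)) has_real_derivative - (V x + \<mu> * B x) * (sol \<mu> x - sol \<mu> (- x))) (at x)"
      using DERIV_add[OF DERIV_flux[OF x(1)] neg[OF DERIV_flux[OF x(2)]]] by (simp add: B_even V_even algebra_simps)
  qed auto
  show "sol \<mu> (- x) = sol \<mu> x" "flux \<mu> (- x) = - flux \<mu> x" if "\<bar>x\<bar> \<le> c"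
    using *[of "\<bar>x\<bar>"] that by (cases "x \<ge> 0"; simp)+
qed

text \<open>By the lower energy estimate \<open>w\<^sup>2 + p\<^sup>2\<close> cannot fall from 1 to 0.\<close>
lemma no_double_zero:
  assumes "0 \<le> x" "x \<le> c"
  shows "sol \<mu> x \<noteq> 0 \<or> flux \<mu> x \<noteq> 0"
proof -
  obtain L where L: "L \<ge> 0" "\<And>x \<mu>'. \<bar>x\<bar> \<le> c \<Longrightarrow> \<bar>\<mu>'\<bar> \<le> \<bar>\<mu>\<bar> \<Longrightarrow> \<bar>1 / B x - (V x + \<mu>' * B x)\<bar> \<le> L"
    using coefficient_bound[of "\<bar>\<mu>\<bar>"] by blast
  have "exp (- L * x) * ((sol \<mu> 0)\<^sup>2 + (flux \<mu> 0)\<^sup>2) \<le> (sol \<mu> x)\<^sup>2 + (flux \<mu> x)\<^sup>2"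
  proof (rule gronwall_lower[OF _ _ assms])
    fix t assume t: "0 \<le> t" "t \<le> c"
    then have t': "\<bar>t\<bar> \<le> c" by simp
    show "((\<lambda>t. (sol \<mu> t)\<^sup>2 + (flux \<mu> t)\<^sup>2) has_real_derivative 2 * (1 / B t - (V t + \<mu> * B t)) * sol \<mu> t * flux \<mu> t) (at t)"
      by (rule derivative_eq_intros DERIV_sol[OF t'] DERIV_flux[OF t'] refl)+ (simp add: algebra_simps)
    show "- L * ((sol \<mu> t)\<^sup>2 + (flux \<mu> t)\<^sup>2) \<le> 2 * (1 / B t - (V t + \<mu> * B t)) * sol \<mu> t * flux \<mu> t"
      using abs_two_mult_le_sum_squares[OF L(2)[of t \<mu>], of "sol \<mu> t" "flux \<mu> t"] t by (auto simp: abs_le_iff)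
  qed
  then have "exp (- L * x) \<le> (sol \<mu> x)\<^sup>2 + (flux \<mu> x)\<^sup>2" by simp
  then have "0 < (sol \<mu> x)\<^sup>2 + (flux \<mu> x)\<^sup>2" by (rule less_le_trans[OF exp_gt_zero])
  then show ?thesis by auto
qed

text \<open>
  The difference of the solutions for \<open>\<nu>\<close> and \<open>\<mu>\<close> solves the system for \<open>\<nu>\<close> with the source
  \<open>(\<nu> - \<mu>) B w\<close> in the flux equation, \<open>w\<close> being the solution for \<open>\<mu>\<close>; Gronwall's inequality bounds
  its energy by a multiple of \<open>(\<nu> - \<mu>)\<^sup>2\<close>.
\<close>
lemma sol_depends_continuously:
  assumes e: "e > 0"
  shows "\<exists>d>0. \<forall>\<nu>. \<bar>\<nu> - \<mu>\<bar> < d \<longrightarrow> (\<forall>x\<in>{0..c}. \<bar>sol \<nu> x - sol \<mu> x\<bar> < e \<and> \<bar>flux \<nu> x - flux \<mu> x\<bar> < e)"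
proof -
  obtain L where L: "L \<ge> 0" "\<And>x \<mu>'. \<bar>x\<bar> \<le> c \<Longrightarrow> \<bar>\<mu>'\<bar> \<le> \<bar>\<mu>\<bar> + 1 \<Longrightarrow> \<bar>1 / B x - (V x + \<mu>' * B x)\<bar> \<le> L"
    using coefficient_bound[of "\<bar>\<mu>\<bar> + 1"] by blast
  have "continuous_on {-c..c} (\<lambda>x. B x * sol \<mu> x)"
    by (intro continuous_on_mult continuous_on_sol continuous_on_subset[OF continuous_B]) auto
  from continuous_bounded[OF this]
  obtain M where M: "M \<ge> 0" "\<And>x. \<bar>x\<bar> \<le> c \<Longrightarrow> \<bar>B x * sol \<mu> x\<bar> \<le> M" by blast
  define Q where "Q = exp ((L + 1) * c) * (M\<^sup>2 * c)"
  have Q: "Q \<ge> 0" using M c_pos by (simp add: Q_def)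
  have est: "(sol \<nu> x - sol \<mu> x)\<^sup>2 + (flux \<nu> x - flux \<mu> x)\<^sup>2 \<le> (\<nu> - \<mu>)\<^sup>2 * Q"
    if \<nu>: "\<bar>\<nu> - \<mu>\<bar> \<le> 1" and x: "0 \<le> x" "x \<le> c" for \<nu> x
  proof -
    let ?d = "\<lambda>t. sol \<nu> t - sol \<mu> t" and ?e = "\<lambda>t. flux \<nu> t - flux \<mu> t"
    have "(?d x)\<^sup>2 + (?e x)\<^sup>2 \<le> exp ((L + 1) * x) * (((?d 0)\<^sup>2 + (?e 0)\<^sup>2) + ((\<nu> - \<mu>)\<^sup>2 * M\<^sup>2) * x)"
    proof (rule gronwall_upper[OF _ _ _ _ x])
      fix t assume t: "0 \<le> t" "t \<le> c"
      then have t': "\<bar>t\<bar> \<le> c" by simp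
      let ?r = "(\<nu> - \<mu>) * (B t * sol \<mu> t)"
      have combine: "X - Y \<le> P + S + Z" if "X \<le> P" "- Y \<le> r2 + e2" "e2 \<le> S" "r2 \<le> Z"
        for X Y P S Z r2 e2 :: real using that by linarith
      show "((\<lambda>t. (?d t)\<^sup>2 + (?e t)\<^sup>2) has_real_derivative
         2 * (1 / B t - (V t + \<nu> * B t)) * ?d t * ?e t - 2 * ?r * ?e t) (at t)"
        by (rule derivative_eq_intros DERIV_sol[OF t'] DERIV_flux[OF t'] refl)+ (simp add: algebra_simps diff_divide_distrib)
      have "\<bar>\<nu>\<bar> \<le> \<bar>\<mu>\<bar> + 1" using \<nu> by linarith
      from abs_two_mult_le_sum_squares[OF L(2)[OF t' this], of "?d t" "?e t"]
      have "2 * (1 / B t - (V t + \<nu> * B t)) * ?d t * ?e t \<le> L * ((?d t)\<^sup>2 + (?e t)\<^sup>2)"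
        by (rule order_trans[OF abs_ge_self])
      moreover have "- (2 * ?r * ?e t) \<le> ?r\<^sup>2 + (?e t)\<^sup>2"
        using zero_le_power2[of "?r + ?e t"] by (simp add: power2_sum)
      moreover have "(?e t)\<^sup>2 \<le> (?d t)\<^sup>2 + (?e t)\<^sup>2" by simp
      moreover have "?r\<^sup>2 \<le> (\<nu> - \<mu>)\<^sup>2 * M\<^sup>2"
      proof -
        have "(B t * sol \<mu> t)\<^sup>2 \<le> M\<^sup>2" using M(2)[OF t'] M(1) by (intro power2_le_iff_abs_le[THEN iffD2]) auto
        then show ?thesis by (simp add: power_mult_distrib[of "\<nu> - \<mu>"] mult_left_mono)
      qed
      ultimately show "2 * (1 / B t - (V t + \<nu> * B t)) * ?d t * ?e t - 2 * ?r * ?e t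
          \<le> (L + 1) * ((?d t)\<^sup>2 + (?e t)\<^sup>2) + (\<nu> - \<mu>)\<^sup>2 * M\<^sup>2"
        using combine by (simp only: distrib_right mult_1)
    qed (use L in auto)
    also have "\<dots> = exp ((L + 1) * x) * ((\<nu> - \<mu>)\<^sup>2 * M\<^sup>2 * x)" by simp
    also have "\<dots> \<le> exp ((L + 1) * c) * ((\<nu> - \<mu>)\<^sup>2 * M\<^sup>2 * c)"
      using x L by (intro mult_mono) (auto intro!: mult_left_mono)
    finally show ?thesis by (simp add: Q_def algebra_simps)
  qed
  show ?thesis
  proof (rule exI[of _ "min 1 (e / sqrt (Q + 1))"], intro conjI allI impI ballI)
    show "0 < min 1 (e / sqrt (Q + 1))" using e Q by auto
    fix \<nu> x assume \<nu>: "\<bar>\<nu> - \<mu>\<bar> < min 1 (e / sqrt (Q + 1))" and x: "x \<in> {0..c}"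
    have "\<bar>\<nu> - \<mu>\<bar> * sqrt (Q + 1) < e" using \<nu> Q by (simp add: pos_less_divide_eq)
    then have "(\<bar>\<nu> - \<mu>\<bar> * sqrt (Q + 1))\<^sup>2 < e\<^sup>2" using Q by (intro power_strict_mono) auto
    then have "(\<nu> - \<mu>)\<^sup>2 * (Q + 1) < e\<^sup>2" using Q by (simp add: power_mult_distrib)
    then have "(\<nu> - \<mu>)\<^sup>2 * Q < e\<^sup>2" by (simp add: distrib_left) (smt (verit) zero_le_power2)
    then have *: "(sol \<nu> x - sol \<mu> x)\<^sup>2 + (flux \<nu> x - flux \<mu> x)\<^sup>2 < e\<^sup>2"
      using est[of \<nu> x] \<nu> x by auto
    have "(sol \<nu> x - sol \<mu> x)\<^sup>2 < e\<^sup>2" "(flux \<nu> x - flux \<mu> x)\<^sup>2 < e\<^sup>2"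
      using * zero_le_power2[of "sol \<nu> x - sol \<mu> x"] zero_le_power2[of "flux \<nu> x - flux \<mu> x"] by linarith+
    then show "\<bar>sol \<nu> x - sol \<mu> x\<bar> < e" "\<bar>flux \<nu> x - flux \<mu> x\<bar> < e"
      using e power2_less_imp_less[of "\<bar>_\<bar>" e] by simp_all
  qed
qed

section \<open>The lowest eigenvalue by shooting\<close>

text \<open>
  For a positive solution the second condition says that the logarithmic derivative at \<open>c\<close> exceeds the
  Robin value. That logarithmic derivative decreases in \<open>\<mu>\<close>, so the first failure marks the lowest
  eigenvalue.
\<close>
definition subcritical :: "real \<Rightarrow> bool" where
  "subcritical \<mu> \<longleftrightarrow> (\<forall>x\<in>{0..c}. sol \<mu> x > 0) \<and> flux \<mu> c > \<beta> * sol \<mu> c"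

lemma subcritical_open:
  assumes "subcritical \<mu>"
  shows "\<exists>d>0. \<forall>\<nu>. \<bar>\<nu> - \<mu>\<bar> < d \<longrightarrow> subcritical \<nu>"
proof -
  have "continuous_on {0..c} (sol \<mu>)" by (rule continuous_on_subset[OF continuous_on_sol]) auto
  then obtain x0 where x0: "x0 \<in> {0..c}" "\<And>x. x \<in> {0..c} \<Longrightarrow> sol \<mu> x0 \<le> sol \<mu> x"
    using continuous_attains_inf[of "{0..c}" "sol \<mu>"] c_pos by auto
  define F where "F = flux \<mu> c - \<beta> * sol \<mu> c"
  \<comment> \<open>Perturbing \<open>w\<close> and \<open>p\<close> by less than \<open>e\<close> changes \<open>p - \<beta> w\<close> by less than \<open>(1 + \<beta>) e\<close>.\<close>
  define e where "e = min (sol \<mu> x0) (F / (1 + \<beta>))"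
  have "e > 0" using assms x0(1) \<beta>_pos by (auto simp: e_def F_def subcritical_def)
  then obtain d where d: "d > 0" "\<And>\<nu> x. \<bar>\<nu> - \<mu>\<bar> < d \<Longrightarrow> x \<in> {0..c} \<Longrightarrow> \<bar>sol \<nu> x - sol \<mu> x\<bar> < e \<and> \<bar>flux \<nu> x - flux \<mu> x\<bar> < e"
    using sol_depends_continuously[of e \<mu>] by blast
  have "subcritical \<nu>" if "\<bar>\<nu> - \<mu>\<bar> < d" for \<nu>
    unfolding subcritical_def
  proof
    show "\<forall>x\<in>{0..c}. 0 < sol \<nu> x"
    proof
      fix x assume x: "x \<in> {0..c}"
      then show "0 < sol \<nu> x" using d(2)[OF that x] x0(2)[OF x] by (auto simp: e_def)
    qed
    have c: "c \<in> {0..c}" using c_pos by auto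
    have "\<beta> * (sol \<nu> c - sol \<mu> c) < \<beta> * e"
      using d(2)[OF that c] \<beta>_pos by (intro mult_strict_left_mono) auto
    moreover have "e * (1 + \<beta>) \<le> F"
      using \<beta>_pos by (subst pos_le_divide_eq[symmetric]) (auto simp: e_def)
    ultimately show "\<beta> * sol \<nu> c < flux \<nu> c"
      using d(2)[OF that c] by (auto simp: F_def algebra_simps)
  qed
  then show ?thesis using d(1) by blast
qed

text \<open>
  If \<open>V + \<mu> B > 0\<close>, the flux of a positive solution decreases from 0, so it cannot reach the positive
  value \<open>\<beta> w(c)\<close>.
\<close>
lemma subcritical_bounded: "\<exists>\<Lambda>. \<forall>\<mu>. subcritical \<mu> \<longrightarrow> \<mu> \<le> \<Lambda>"
proof -
  have "continuous_on {-c..c} (\<lambda>x. V x / B x)"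
    using B_pos by (auto intro!: continuous_intros continuous_on_subset[OF continuous_B] continuous_on_subset[OF continuous_V]
      simp: less_imp_neq[symmetric])
  from continuous_bounded[OF this]
  obtain \<Lambda> where \<Lambda>: "\<And>x. \<bar>x\<bar> \<le> c \<Longrightarrow> \<bar>V x / B x\<bar> \<le> \<Lambda>" by blast
  have "\<mu> \<le> \<Lambda>" if "subcritical \<mu>" for \<mu>
  proof (rule ccontr)
    assume "\<not> \<mu> \<le> \<Lambda>"
    have "flux \<mu> c \<le> flux \<mu> 0"
    proof (rule DERIV_nonpos_imp_nonincreasing[of 0 c, OF less_imp_le[OF c_pos]])
      fix x assume x: "0 \<le> x" "x \<le> c"
      have "\<bar>V x / B x\<bar> \<le> \<Lambda>" using \<Lambda>[of x] x by simp
      then have "- \<mu> < V x / B x" using \<open>\<not> \<mu> \<le> \<Lambda>\<close> by linarith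
      then have "V x + \<mu> * B x > 0" using B_pos[of x] by (simp add: field_simps)
      moreover have "sol \<mu> x > 0" using that x by (simp add: subcritical_def)
      ultimately have "- (V x + \<mu> * B x) * sol \<mu> x \<le> 0" by (intro mult_nonpos_nonneg) auto
      then show "\<exists>y. (flux \<mu> has_real_derivative y) (at x) \<and> y \<le> 0" using DERIV_flux[of x \<mu>] x by force
    qed
    moreover have "\<beta> * sol \<mu> c > 0" using that \<beta>_pos c_pos by (simp add: subcritical_def)
    ultimately show False using that by (simp add: subcritical_def)
  qed
  then show ?thesis by blast
qed

text \<open>
  Sturm comparison. With \<open>Q = B \<rho>'\<close>, the Wronskian \<open>\<omega> = \<rho> p - Q w\<close> satisfies
  \<open>\<omega>' = - (Q' + V \<rho>) w\<close> and \<open>(w / \<rho>)' = \<omega> / (B \<rho>\<^sup>2)\<close>. Up to a first zero of \<open>w\<close> the Wronskian increases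
  from 0, so \<open>w / \<rho>\<close> increases as well and the zero cannot occur. At \<open>c\<close> the positive Wronskian
  together with the boundary inequality for \<open>\<rho>\<close> gives the strict Robin inequality for \<open>w\<close>.
\<close>
lemma supersolution_imp_subcritical_0:
  assumes \<rho>: "\<And>x. 0 \<le> x \<Longrightarrow> x \<le> c \<Longrightarrow> \<rho> x > 0"
    and D\<rho>: "\<And>x. 0 \<le> x \<Longrightarrow> x \<le> c \<Longrightarrow> (\<rho> has_real_derivative Q x / B x) (at x)"
    and DQ: "\<And>x. 0 \<le> x \<Longrightarrow> x \<le> c \<Longrightarrow> (Q has_real_derivative Q' x) (at x)"
    and super: "\<And>x. 0 < x \<Longrightarrow> x < c \<Longrightarrow> Q' x + V x * \<rho> x < 0"
    and Q0: "Q 0 = 0" and Qc: "Q c \<ge> \<beta> * \<rho> c"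
  shows "subcritical 0"
proof -
  let ?w = "sol 0" and ?p = "flux 0"
  define \<omega> where "\<omega> x = \<rho> x * ?p x - Q x * ?w x" for x
  have D\<omega>: "(\<omega> has_real_derivative - (Q' x + V x * \<rho> x) * ?w x) (at x)" if "0 \<le> x" "x \<le> c" for x
  proof -
    have x: "\<bar>x\<bar> \<le> c" using that by simp
    show ?thesis unfolding \<omega>_def
      by (rule derivative_eq_intros D\<rho>[OF that] DQ[OF that] DERIV_sol[OF x] DERIV_flux[OF x] refl)+
         (simp add: algebra_simps)
  qed
  have Dq: "((\<lambda>x. ?w x / \<rho> x) has_real_derivative \<omega> x / (B x * (\<rho> x)\<^sup>2)) (at x)" if "0 \<le> x" "x \<le> c" for x
  proof -
    have x: "\<bar>x\<bar> \<le> c" using that by simp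
    have "((\<lambda>x. ?w x / \<rho> x) has_real_derivative (?p x / B x * \<rho> x - ?w x * (Q x / B x)) / (\<rho> x * \<rho> x)) (at x)"
      using \<rho>[OF that] by (intro DERIV_divide DERIV_sol D\<rho> x that) auto
    then show ?thesis using \<rho>[OF that] B_pos[of x]
      by (simp add: \<omega>_def power2_eq_square field_simps)
  qed
  have c\<omega>: "continuous_on {0..t} \<omega>" and cq: "continuous_on {0..t} (\<lambda>x. ?w x / \<rho> x)" if "t \<le> c" for t
  proof -
    show "continuous_on {0..t} \<omega>"
      using that by (intro continuous_at_imp_continuous_on ballI, intro DERIV_isCont[OF D\<omega>]) auto
    show "continuous_on {0..t} (\<lambda>x. ?w x / \<rho> x)"
      using that by (intro continuous_at_imp_continuous_on ballI, intro DERIV_isCont[OF Dq]) auto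
  qed
  have \<omega>0: "\<omega> 0 = 0" using Q0 by (simp add: \<omega>_def)
  have pos: "?w x > 0" if x: "x \<in> {0..c}" for x
  proof (rule ccontr)
    assume neg: "\<not> ?w x > 0"
    define S where "S = {x \<in> {0..c}. ?w x \<le> 0}"
    have "continuous_on {0..c} ?w" by (rule continuous_on_subset[OF continuous_on_sol]) auto
    then have "closed S" unfolding S_def
      by (intro continuous_on_closed_Collect_le continuous_intros) auto
    then have "compact ({0..c} \<inter> S)" by (intro compact_Int_closed) auto
    moreover have "{0..c} \<inter> S = S" by (auto simp: S_def)
    ultimately have "compact S" by simp
    moreover have "x \<in> S" using neg x by (simp add: S_def)
    ultimately obtain t where t: "t \<in> S" "\<And>y. y \<in> S \<Longrightarrow> t \<le> y" using compact_attains_inf[of S] by auto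
    have tc: "0 \<le> t" "t \<le> c" using t(1) by (auto simp: S_def)
    have before: "?w y > 0" if "0 \<le> y" "y < t" for y
      using t(2)[of y] that tc by (force simp: S_def)
    have \<omega>_nonneg: "\<omega> y \<ge> 0" if "0 \<le> y" "y \<le> t" for y
    proof -
      have "\<omega> 0 \<le> \<omega> y"
      proof (rule DERIV_nonneg_imp_increasing_open[OF that(1)])
        fix z assume z: "0 < z" "z < y"
        have "- (Q' z + V z * \<rho> z) * ?w z \<ge> 0"
          using super[of z] before[of z] z that tc by (intro mult_nonneg_nonneg) auto
        then show "\<exists>r. (\<omega> has_real_derivative r) (at z) \<and> 0 \<le> r" using D\<omega>[of z] z that tc by force
      qed (rule c\<omega>, use that tc in simp)
      then show ?thesis by (simp add: \<omega>0)
    qed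
    have "?w 0 / \<rho> 0 \<le> ?w t / \<rho> t"
    proof (rule DERIV_nonneg_imp_nondecreasing[OF tc(1)])
      fix z assume z: "0 \<le> z" "z \<le> t"
      have "\<omega> z / (B z * (\<rho> z)\<^sup>2) \<ge> 0" using \<omega>_nonneg[OF z] less_imp_le[OF B_pos[of z]] by simp
      then show "\<exists>r. ((\<lambda>x. ?w x / \<rho> x) has_real_derivative r) (at z) \<and> 0 \<le> r" using Dq[of z] z tc by force
    qed
    moreover have "?w 0 / \<rho> 0 > 0" using \<rho>[of 0] c_pos by simp
    ultimately have "0 < ?w t / \<rho> t" by (rule less_le_trans[rotated])
    then have "?w t > 0" using \<rho>[OF tc] by (simp add: zero_less_divide_iff)
    then show False using t(1) by (simp add: S_def)
  qed
  have "\<omega> 0 < \<omega> c"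
  proof (rule DERIV_pos_imp_increasing_open[OF c_pos])
    fix z assume z: "0 < z" "z < c"
    have "- (Q' z + V z * \<rho> z) * ?w z > 0"
      using super[OF z] pos[of z] z by (intro mult_pos_pos) auto
    then show "\<exists>r. (\<omega> has_real_derivative r) (at z) \<and> 0 < r" using D\<omega>[of z] z by force
  qed (rule c\<omega>, simp)
  then have "Q c * ?w c < \<rho> c * ?p c" by (simp add: \<omega>0) (simp add: \<omega>_def)
  moreover have "(\<beta> * \<rho> c) * ?w c \<le> Q c * ?w c" using Qc pos[of c] c_pos by (intro mult_right_mono) auto
  ultimately have "\<rho> c * (\<beta> * ?w c) < \<rho> c * ?p c" by (simp add: algebra_simps)
  then have "\<beta> * ?w c < ?p c" using \<rho>[of c] c_pos by (simp add: mult_less_cancel_left)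
  then show ?thesis using pos by (simp add: subcritical_def)
qed

text \<open>
  At the supremum of the subcritical parameters both conditions hold in the weak sense by continuous
  dependence. A zero of \<open>w\<close> there would be a minimum, in the interior or, by the boundary inequality, at
  \<open>c\<close>, and in either case a double zero. So \<open>w > 0\<close>, and as the supremum is not itself subcritical by
  openness, the Robin condition holds with equality.
\<close>
lemma ground_state_exists:
  assumes "subcritical 0"
  obtains \<mu> where "\<mu> > 0" "\<And>x. \<bar>x\<bar> \<le> c \<Longrightarrow> sol \<mu> x > 0" "flux \<mu> c = \<beta> * sol \<mu> c"
proof -
  obtain \<Lambda> where \<Lambda>: "\<And>\<mu>. subcritical \<mu> \<Longrightarrow> \<mu> \<le> \<Lambda>" using subcritical_bounded by blast
  have bdd: "bdd_above (Collect subcritical)" using \<Lambda> by (auto intro!: bdd_aboveI)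
  define \<mu> where "\<mu> = Sup (Collect subcritical)"
  have not_sub: "\<not> subcritical \<mu>"
  proof
    assume "subcritical \<mu>"
    then obtain d where "d > 0" "\<And>\<nu>. \<bar>\<nu> - \<mu>\<bar> < d \<Longrightarrow> subcritical \<nu>" using subcritical_open by blast
    then have "subcritical (\<mu> + d/2)" by simp
    then have "\<mu> + d/2 \<le> \<mu>" unfolding \<mu>_def by (intro cSup_upper bdd) auto
    then show False using \<open>d > 0\<close> by simp
  qed
  obtain d where d: "d > 0" "\<And>\<nu>. \<bar>\<nu> - 0\<bar> < d \<Longrightarrow> subcritical \<nu>" using subcritical_open[OF assms] by blast
  have "d / 2 \<le> \<mu>" unfolding \<mu>_def using d by (intro cSup_upper bdd) auto
  then have "\<mu> > 0" using d by simp
  have approx: "\<exists>\<nu>. subcritical \<nu> \<and> (\<forall>x\<in>{0..c}. \<bar>sol \<nu> x - sol \<mu> x\<bar> < e \<and> \<bar>flux \<nu> x - flux \<mu> x\<bar> < e)" if e: "e > 0" for e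
  proof -
    obtain d where d: "d > 0" "\<And>\<nu>. \<bar>\<nu> - \<mu>\<bar> < d \<Longrightarrow> (\<forall>x\<in>{0..c}. \<bar>sol \<nu> x - sol \<mu> x\<bar> < e \<and> \<bar>flux \<nu> x - flux \<mu> x\<bar> < e)"
      using sol_depends_continuously[OF e, of \<mu>] by blast
    obtain \<nu> where "subcritical \<nu>" "\<nu> > \<mu> - d"
      using less_cSup_iff[OF _ bdd, of "\<mu> - d"] assms d(1) unfolding \<mu>_def by auto
    moreover have "\<nu> \<le> \<mu>" using \<open>subcritical \<nu>\<close> unfolding \<mu>_def by (intro cSup_upper bdd) auto
    ultimately show ?thesis using d(1) d(2)[of \<nu>] by auto
  qed
  have nonneg: "sol \<mu> x \<ge> 0" if x: "x \<in> {0..c}" for x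
  proof (rule ccontr)
    assume "\<not> sol \<mu> x \<ge> 0"
    then obtain \<nu> where "subcritical \<nu>" "\<bar>sol \<nu> x - sol \<mu> x\<bar> < - sol \<mu> x"
      using approx[of "- sol \<mu> x"] x by auto
    moreover have "sol \<nu> x > 0" using \<open>subcritical \<nu>\<close> x by (auto simp: subcritical_def)
    ultimately show False by linarith
  qed
  have F: "flux \<mu> c \<ge> \<beta> * sol \<mu> c"
  proof (rule ccontr)
    assume *: "\<not> flux \<mu> c \<ge> \<beta> * sol \<mu> c"
    define e where "e = (\<beta> * sol \<mu> c - flux \<mu> c) / (1 + \<beta>)"
    have "e > 0" using * \<beta>_pos by (simp add: e_def)
    then obtain \<nu> where \<nu>: "subcritical \<nu>" "\<bar>sol \<nu> c - sol \<mu> c\<bar> < e" "\<bar>flux \<nu> c - flux \<mu> c\<bar> < e"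
      using approx[of e] c_pos by auto
    have "\<beta> * (sol \<mu> c - sol \<nu> c) < \<beta> * e" using \<nu>(2) \<beta>_pos by (intro mult_strict_left_mono) auto
    moreover have "e * (1 + \<beta>) = \<beta> * sol \<mu> c - flux \<mu> c" using \<beta>_pos by (simp add: e_def)
    moreover have "flux \<nu> c > \<beta> * sol \<nu> c" using \<nu>(1) by (simp add: subcritical_def)
    ultimately show False using \<nu>(3) by (auto simp: algebra_simps)
  qed
  have pos: "sol \<mu> x > 0" if x: "x \<in> {0..c}" for x
  proof (rule ccontr)
    assume "\<not> sol \<mu> x > 0"
    then have z: "sol \<mu> x = 0" using nonneg[OF x] by simp
    then have "x \<noteq> 0" by auto
    then have xp: "x > 0" using x by auto
    have D: "(sol \<mu> has_real_derivative flux \<mu> x / B x) (at x)" using DERIV_sol[of x \<mu>] x by auto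
    have "flux \<mu> x / B x \<le> 0"
    proof (rule ccontr)
      assume "\<not> flux \<mu> x / B x \<le> 0"
      then obtain d where d: "d > 0" "\<And>h. h > 0 \<Longrightarrow> h < d \<Longrightarrow> sol \<mu> (x - h) < sol \<mu> x"
        using DERIV_pos_inc_left[OF D] by auto
      have "sol \<mu> (x - min (d/2) x) < 0" using d(2)[of "min (d/2) x"] d(1) xp z by auto
      moreover have "x - min (d/2) x \<in> {0..c}" using x xp d(1) by auto
      ultimately show False using nonneg[of "x - min (d/2) x"] by linarith
    qed
    moreover have "flux \<mu> x / B x \<ge> 0"
    proof (cases "x = c")
      case True then show ?thesis using F z B_pos[of x] by simp
    next
      case False
      show ?thesis
      proof (rule ccontr)
        assume "\<not> flux \<mu> x / B x \<ge> 0"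
        then obtain d where d: "d > 0" "\<And>h. h > 0 \<Longrightarrow> h < d \<Longrightarrow> sol \<mu> (x + h) < sol \<mu> x"
          using DERIV_neg_dec_right[OF D] by auto
        have "sol \<mu> (x + min (d/2) (c - x)) < 0" using d(2)[of "min (d/2) (c - x)"] d(1) x False z by auto
        moreover have "x + min (d/2) (c - x) \<in> {0..c}" using x xp d(1) by auto
        ultimately show False using nonneg[of "x + min (d/2) (c - x)"] by linarith
      qed
    qed
    ultimately have "flux \<mu> x = 0" using B_pos[of x] by (simp add: divide_le_0_iff zero_le_divide_iff)
    then show False using no_double_zero[of x \<mu>] z x by auto
  qed
  have "flux \<mu> c = \<beta> * sol \<mu> c" using F not_sub pos by (force simp: subcritical_def)
  moreover have "sol \<mu> x > 0" if "\<bar>x\<bar> \<le> c" for x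
    using pos[of "\<bar>x\<bar>"] sol_even[OF that, of \<mu>] that by (cases "x \<ge> 0") auto
  ultimately show ?thesis using that \<open>\<mu> > 0\<close> by blast
qed

section \<open>Variational characterisation of the ground state\<close>

text \<open>
  Integration by parts against the flux. Only the function \<open>w\<close> is smooth; \<open>v\<close> is merely a primitive
  of \<open>h\<close>.
\<close>
lemma ground_state_weak_equation:
  assumes bc: "flux \<mu> c = \<beta> * sol \<mu> c"
    and v: "continuous_on {-c..c} v" "primitive_on (-c) c v h"
  shows "(LBINT s:{-c<..<c}. B s * (flux \<mu> s / B s * h s) - V s * (sol \<mu> s * v s))
     - \<beta> * (sol \<mu> c * v c + sol \<mu> (- c) * v (- c)) = \<mu> * (LBINT s:{-c<..<c}. B s * (sol \<mu> s * v s))"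
proof -
  let ?w = "sol \<mu>" and ?p = "flux \<mu>"
  have cB: "continuous_on {-c..c} B" and cV: "continuous_on {-c..c} V"
    by (auto intro: continuous_on_subset[OF continuous_B] continuous_on_subset[OF continuous_V])
  have hi: "set_integrable lborel {-c<..<c} h" using v(2) by (simp add: primitive_on_def)
  have "primitive_on (-c) c ?p (\<lambda>x. - (V x + \<mu> * B x) * ?w x)"
  proof (rule C1_imp_primitive_on)
    show "(?p has_real_derivative - (V x + \<mu> * B x) * ?w x) (at x)" if "- c \<le> x" "x \<le> c" for x
      using that by (intro DERIV_flux) auto
  qed (intro continuous_intros cB cV continuous_on_sol)
  from primitive_on_mult[OF this v(2) continuous_on_flux v(1)]
  have "?p c * v c - ?p (- c) * v (- c) = (LBINT s:{-c<..<c}. - (V s + \<mu> * B s) * ?w s * v s + h s * ?p s)"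
    using c_pos by (simp add: primitive_on_def)
  moreover have "?p c * v c - ?p (- c) * v (- c) = \<beta> * (?w c * v c + ?w (- c) * v (- c))"
    using bc c_pos by (simp add: sol_even flux_odd algebra_simps)
  moreover have "(LBINT s:{-c<..<c}. B s * (?p s / B s * h s) - V s * (?w s * v s)) =
     (LBINT s:{-c<..<c}. (- (V s + \<mu> * B s) * ?w s * v s + h s * ?p s) + \<mu> * (B s * (?w s * v s)))"
  proof (rule set_lebesgue_integral_cong, simp, intro allI impI)
    fix s
    have "B s \<noteq> 0" using B_pos[of s] by simp
    then show "B s * (?p s / B s * h s) - V s * (?w s * v s) =
      (- (V s + \<mu> * B s) * ?w s * v s + h s * ?p s) + \<mu> * (B s * (?w s * v s))"
      by (simp add: algebra_simps)
  qed
  moreover have "\<dots> = (LBINT s:{-c<..<c}. - (V s + \<mu> * B s) * ?w s * v s + h s * ?p s) + (LBINT s:{-c<..<c}. \<mu> * (B s * (?w s * v s)))"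
  proof (rule set_integral_add(2))
    show "set_integrable lborel {-c<..<c} (\<lambda>s. - (V s + \<mu> * B s) * ?w s * v s + h s * ?p s)"
      by (intro set_integral_add(1) set_integrable_mult_continuous[OF hi] continuous_on_flux
        continuous_imp_set_integrable_Ioo continuous_intros cB cV continuous_on_sol v(1))
    show "set_integrable lborel {-c<..<c} (\<lambda>s. \<mu> * (B s * (?w s * v s)))"
      by (intro continuous_imp_set_integrable_Ioo continuous_intros cB continuous_on_sol v(1))
  qed
  ultimately show ?thesis by simp
qed

text \<open>
  Jacobi's trick: \<open>\<psi> = B w' / w\<close> solves the Riccati equation \<open>\<psi>' = - (V + \<mu> B) - \<psi>\<^sup>2 / B\<close> with
  \<open>\<psi>(\<plusminus>c) = \<plusminus>\<beta>\<close>. Expressing the boundary term as \<open>\<integral> (\<psi> u\<^sup>2)'\<close> completes the square, and the form minus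
  \<open>\<mu> \<integral> B u\<^sup>2\<close> equals \<open>\<integral> (B u' - \<psi> u)\<^sup>2 / B\<close>.
\<close>
lemma ground_state_minimal:
  assumes pos: "\<And>x. \<bar>x\<bar> \<le> c \<Longrightarrow> sol \<mu> x > 0" and bc: "flux \<mu> c = \<beta> * sol \<mu> c"
    and u: "continuous_on {-c..c} u" "primitive_on (-c) c u g" "L2_on {-c<..<c} g"
  shows "\<mu> * (LBINT s:{-c<..<c}. B s * (u s * u s)) \<le>
    (LBINT s:{-c<..<c}. B s * (g s * g s) - V s * (u s * u s)) - \<beta> * (u c * u c + u (- c) * u (- c))"
proof -
  let ?w = "sol \<mu>" and ?p = "flux \<mu>"
  define \<psi> where "\<psi> = (\<lambda>x. ?p x / ?w x)"
  define \<psi>' where "\<psi>' = (\<lambda>x. - (V x + \<mu> * B x) - (\<psi> x)\<^sup>2 / B x)"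
  have nz: "?w x \<noteq> 0" if "x \<in> {-c..c}" for x
  proof -
    have "\<bar>x\<bar> \<le> c" using that by auto
    then show ?thesis using pos[of x] by simp
  qed
  have Bnz: "B x \<noteq> 0" for x using B_pos[of x] by simp
  have cB: "continuous_on {-c..c} B" and cV: "continuous_on {-c..c} V"
    by (auto intro: continuous_on_subset[OF continuous_B] continuous_on_subset[OF continuous_V])
  have c\<psi>: "continuous_on {-c..c} \<psi>"
    unfolding \<psi>_def using nz by (intro continuous_intros continuous_on_sol continuous_on_flux) auto
  have c\<psi>': "continuous_on {-c..c} \<psi>'"
    unfolding \<psi>'_def using Bnz by (intro continuous_intros cB cV c\<psi>) auto
  have D: "(\<psi> has_real_derivative \<psi>' x) (at x)" if "-c \<le> x" "x \<le> c" for x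
  proof -
    have x: "\<bar>x\<bar> \<le> c" using that by auto
    have "(\<psi> has_real_derivative ((- (V x + \<mu> * B x) * ?w x) * ?w x - ?p x * (?p x / B x)) / (?w x * ?w x)) (at x)"
      unfolding \<psi>_def by (intro DERIV_divide DERIV_flux DERIV_sol x) (use nz that in auto)
    also have "((- (V x + \<mu> * B x) * ?w x) * ?w x - ?p x * (?p x / B x)) / (?w x * ?w x) = \<psi>' x"
      using nz[of x] that Bnz[of x] by (simp add: \<psi>'_def \<psi>_def field_simps power2_eq_square)
    finally show ?thesis .
  qed
  have gi: "set_integrable lborel {-c<..<c} g" using u(2) by (simp add: primitive_on_def)
  have g2: "set_integrable lborel {-c<..<c} (\<lambda>s. (g s)\<^sup>2)" using u(3) by (simp add: L2_on_def)
  have "primitive_on (-c) c (\<lambda>x. \<psi> x * (u x * u x)) (\<lambda>x. \<psi>' x * (u x * u x) + (g x * u x + g x * u x) * \<psi> x)"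
    by (intro primitive_on_mult C1_imp_primitive_on D c\<psi> c\<psi>' u continuous_on_mult)
  then have "\<psi> c * (u c * u c) - \<psi> (- c) * (u (- c) * u (- c)) =
     (LBINT s:{-c<..<c}. \<psi>' s * (u s * u s) + (g s * u s + g s * u s) * \<psi> s)"
    and ibp_int: "set_integrable lborel {-c<..<c} (\<lambda>s. \<psi>' s * (u s * u s) + (g s * u s + g s * u s) * \<psi> s)"
    using c_pos by (auto simp: primitive_on_def)
  moreover have "\<psi> c = \<beta>" "\<psi> (- c) = - \<beta>"
    using bc c_pos pos[of c] by (simp_all add: \<psi>_def sol_even flux_odd)
  ultimately have bdry: "\<beta> * (u c * u c + u (- c) * u (- c)) =
     (LBINT s:{-c<..<c}. \<psi>' s * (u s * u s) + (g s * u s + g s * u s) * \<psi> s)"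
    by (simp add: algebra_simps)
  have i1: "set_integrable lborel {-c<..<c} (\<lambda>s. B s * (g s * g s) - V s * (u s * u s))"
  proof (rule set_integral_diff(1))
    show "set_integrable lborel {-c<..<c} (\<lambda>s. B s * (g s * g s))"
      using set_integrable_mult_continuous[OF g2 cB] by (simp add: power2_eq_square mult.commute)
    show "set_integrable lborel {-c<..<c} (\<lambda>s. V s * (u s * u s))"
      by (intro continuous_imp_set_integrable_Ioo continuous_intros cV u)
  qed
  have i2: "set_integrable lborel {-c<..<c} (\<lambda>s. \<mu> * (B s * (u s * u s)))"
    by (intro continuous_imp_set_integrable_Ioo continuous_intros cB u)
  have "0 \<le> (LBINT s:{-c<..<c}. (B s * g s - \<psi> s * u s)\<^sup>2 / B s)"
    unfolding set_lebesgue_integral_def by (intro integral_nonneg_AE AE_I2) (simp add: less_imp_le[OF B_pos])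
  also have "\<dots> = (LBINT s:{-c<..<c}. (B s * (g s * g s) - V s * (u s * u s)) -
      (\<psi>' s * (u s * u s) + (g s * u s + g s * u s) * \<psi> s) - \<mu> * (B s * (u s * u s)))"
  proof (rule set_lebesgue_integral_cong, simp, intro allI impI)
    fix s
    have "\<psi>' s * B s = - (V s + \<mu> * B s) * B s - (\<psi> s)\<^sup>2"
      using Bnz[of s] by (simp add: \<psi>'_def field_simps)
    then have "((B s * (g s * g s) - V s * (u s * u s)) -
      (\<psi>' s * (u s * u s) + (g s * u s + g s * u s) * \<psi> s) - \<mu> * (B s * (u s * u s))) * B s = (B s * g s - \<psi> s * u s)\<^sup>2"
      by algebra
    then show "(B s * g s - \<psi> s * u s)\<^sup>2 / B s = (B s * (g s * g s) - V s * (u s * u s)) -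
      (\<psi>' s * (u s * u s) + (g s * u s + g s * u s) * \<psi> s) - \<mu> * (B s * (u s * u s))"
      by (rule nonzero_eq_divide_eq[OF Bnz, THEN iffD2, symmetric])
  qed
  also have "\<dots> = (LBINT s:{-c<..<c}. B s * (g s * g s) - V s * (u s * u s)) -
      \<beta> * (u c * u c + u (- c) * u (- c)) - \<mu> * (LBINT s:{-c<..<c}. B s * (u s * u s))"
    using i1 i2 ibp_int bdry by (simp add: set_integral_diff)
  finally show ?thesis by simp
qed

end

section \<open>Geometry of the critical catenoid\<close>

definition cat_B' :: "real \<Rightarrow> real \<Rightarrow> real" where
  "cat_B' a s = a * sinh (2 * s) / cat_B a s"

context
  fixes a :: real
  assumes a: "a > 1/2"
begin

lemma a_cosh_gt: "a * cosh (2 * s) > 1/2"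
proof -
  have "1/2 < a * 1" using a by simp
  also have "\<dots> \<le> a * cosh (2 * s)" using a cosh_real_ge_1[of "2 * s"] by (intro mult_left_mono) auto
  finally show ?thesis .
qed

lemma cat_B_pos: "cat_B a s > 0" and cat_A_pos: "cat_A a s > 0"
  using a_cosh_gt[of s] by (auto simp: cat_B_def cat_A_def)

lemma cat_B_power2: "(cat_B a s)\<^sup>2 = a * cosh (2 * s) - 1/2"
  and cat_A_power2: "(cat_A a s)\<^sup>2 = a * cosh (2 * s) + 1/2"
  using a_cosh_gt[of s] by (auto simp: cat_B_def cat_A_def)

lemma cat_K_pos: "cat_K a > 0" and cat_K_power2: "(cat_K a)\<^sup>2 = a\<^sup>2 - 1/4"
proof -
  have "(1/2)\<^sup>2 < a\<^sup>2" using a by (intro power_strict_mono) auto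
  then have "a\<^sup>2 - 1/4 > 0" by (simp add: power2_eq_square)
  then show "cat_K a > 0" "(cat_K a)\<^sup>2 = a\<^sup>2 - 1/4" by (auto simp: cat_K_def)
qed

lemma a_sinh_power2: "(a * sinh (2 * s))\<^sup>2 = (cat_B a s)^4 + (cat_B a s)\<^sup>2 - (cat_K a)\<^sup>2"
proof -
  have "(cat_B a s)^4 = (a * cosh (2 * s) - 1/2)\<^sup>2"
    by (simp add: cat_B_power2[symmetric] flip: power_mult)
  moreover have "(a * sinh (2 * s))\<^sup>2 = (a * cosh (2 * s))\<^sup>2 - a\<^sup>2"
    by (simp add: power_mult_distrib sinh_square_eq algebra_simps)
  ultimately show ?thesis
    by (simp only: cat_K_power2 cat_B_power2) (simp add: power2_eq_square algebra_simps)
qed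

lemma continuous_on_cat_B: "continuous_on S (cat_B a)" and continuous_on_cat_A: "continuous_on S (cat_A a)"
  unfolding cat_B_def[abs_def] cat_A_def[abs_def] by (intro continuous_intros)+

lemma continuous_on_cat_B': "continuous_on S (cat_B' a)"
  unfolding cat_B'_def[abs_def] using cat_B_pos
  by (intro continuous_intros continuous_on_cat_B) (auto simp: less_imp_neq[symmetric])

lemma DERIV_cat_B: "(cat_B a has_real_derivative cat_B' a s) (at s)"
proof -
  have "((\<lambda>s. a * cosh (2 * s) - 1/2) has_real_derivative 2 * (a * sinh (2 * s))) (at s)"
    by (auto intro!: derivative_eq_intros)
  from DERIV_real_sqrt[THEN DERIV_chain2, OF _ this] a_cosh_gt[of s]
  show ?thesis unfolding cat_B_def[abs_def] cat_B'_def by (simp add: field_simps cat_B_def)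
qed

lemma cat_B'_power2: "(cat_B' a s)\<^sup>2 = (cat_B a s)\<^sup>2 + 1 - (cat_K a)\<^sup>2 / (cat_B a s)\<^sup>2"
  using cat_B_pos[of s]
  by (simp only: cat_B'_def power_divide a_sinh_power2)
     (simp add: field_simps power2_eq_square power4_eq_xxxx)

lemma cat_B'_pos: "s > 0 \<Longrightarrow> cat_B' a s > 0"
  using a cat_B_pos[of s] by (simp add: cat_B'_def)

lemma cat_B_strict_mono: "0 \<le> s \<Longrightarrow> s < t \<Longrightarrow> cat_B a s < cat_B a t"
  using a by (simp add: cat_B_def cosh_real_nonneg_less_iff)

lemma cat_B'_strict_mono: assumes "0 < s" "s < t" shows "cat_B' a s < cat_B' a t"
proof -
  have lt: "(cat_B a s)\<^sup>2 < (cat_B a t)\<^sup>2"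
    using cat_B_strict_mono[of s t] assms cat_B_pos[of s] by (intro power_strict_mono) auto
  moreover have "(cat_K a)\<^sup>2 / (cat_B a t)\<^sup>2 \<le> (cat_K a)\<^sup>2 / (cat_B a s)\<^sup>2"
    by (rule divide_left_mono[OF less_imp_le[OF lt]]) (use cat_B_pos[of s] cat_B_pos[of t] in auto)
  ultimately have "(cat_B' a s)\<^sup>2 < (cat_B' a t)\<^sup>2" unfolding cat_B'_power2 by linarith
  then show ?thesis by (rule power2_less_imp_less) (use cat_B'_pos[of t] assms in simp)
qed

lemma cat_phi_integrand_continuous: "continuous_on S (\<lambda>t. cat_K a / ((cat_A a t)\<^sup>2 * cat_B a t))"
  using cat_A_pos cat_B_pos
  by (intro continuous_intros continuous_on_cat_A continuous_on_cat_B) (auto simp: less_imp_neq[symmetric])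

lemma DERIV_cat_phi: "(cat_phi a has_real_derivative cat_K a / ((cat_A a s)\<^sup>2 * cat_B a s)) (at s)"
  unfolding cat_phi_def[abs_def] by (rule DERIV_LBINT_0[OF cat_phi_integrand_continuous])

lemma cat_phi_0: "cat_phi a 0 = 0"
  by (simp add: cat_phi_def flip: zero_ereal_def)

lemma cat_phi_strict_mono: "s < t \<Longrightarrow> cat_phi a s < cat_phi a t"
proof (rule DERIV_pos_imp_increasing[of s t "cat_phi a"])
  fix x
  show "\<exists>y. (cat_phi a has_real_derivative y) (at x) \<and> 0 < y"
    by (rule exI, rule conjI[OF DERIV_cat_phi]) (use cat_A_pos[of x] cat_B_pos[of x] cat_K_pos in simp)
qed

lemma cat_phi_pos: "s > 0 \<Longrightarrow> cat_phi a s > 0"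
  using cat_phi_strict_mono[of 0 s] by (simp add: cat_phi_0)

lemma continuous_on_cat_phi: "continuous_on S (cat_phi a)"
  using DERIV_cat_phi by (meson DERIV_isCont continuous_at_imp_continuous_on)

text \<open>
  Clearing the denominator leaves an equation whose left-hand side is a product of two increasing
  functions and is regular at \<open>s = 0\<close>; existence and uniqueness of the solution are read off from it.
\<close>
lemma cat_s0_equation_iff:
  assumes "s > 0"
  shows "tanh (cat_phi a s) = cat_B a s * cat_K a / (a * sinh (2 * s)) \<longleftrightarrow> tanh (cat_phi a s) * cat_B' a s = cat_K a"
  using assms a cat_B_pos[of s] by (simp add: cat_B'_def field_simps)

lemma ex1_cat_s0: "\<exists>!s. s > 0 \<and> tanh (cat_phi a s) = cat_B a s * cat_K a / (a * sinh (2 * s))"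
proof (rule ex_ex1I)
  define \<tau> where "\<tau> = tanh (cat_phi a 1)"
  have \<tau>: "\<tau> > 0" using cat_phi_pos[of 1] by (simp add: \<tau>_def)
  define N where "N = cat_K a / \<tau>"
  have N: "N > 0" using \<tau> cat_K_pos by (simp add: N_def)
  \<comment> \<open>\<open>S\<close> is so large that \<open>(B')\<^sup>2 \<ge> a cosh 2S - a \<ge> N\<^sup>2\<close>; since \<open>\<phi>\<close> increases, the product
    is at least \<open>K\<close> there.\<close>
  define S where "S = max 1 (arcosh (1 + N\<^sup>2 / a) / 2)"
  have "1 + N\<^sup>2 / a \<ge> 1" using a by simp
  then have "1 + N\<^sup>2 / a = cosh (arcosh (1 + N\<^sup>2 / a))" "arcosh (1 + N\<^sup>2 / a) \<ge> 0" by auto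
  moreover have "arcosh (1 + N\<^sup>2 / a) \<le> 2 * S" by (simp add: S_def)
  ultimately have "1 + N\<^sup>2 / a \<le> cosh (2 * S)"
    using cosh_real_nonneg_le_iff[of "arcosh (1 + N\<^sup>2 / a)" "2 * S"] by linarith
  then have "a * (1 + N\<^sup>2 / a) \<le> a * cosh (2 * S)" using a by (intro mult_left_mono) auto
  then have aN: "a + N\<^sup>2 \<le> a * cosh (2 * S)" using a by (simp add: distrib_left)
  have S1: "S \<ge> 1" by (simp add: S_def)
  have "(cat_K a)\<^sup>2 / (cat_B a S)\<^sup>2 \<le> (cat_K a)\<^sup>2 / (a - 1/2)"
  proof -
    have "a - 1/2 \<le> a * cosh (2 * S) - 1/2" using aN zero_le_power2[of N] by linarith
    then show ?thesis unfolding cat_B_power2 by (rule divide_left_mono) (use a a_cosh_gt[of S] in auto)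
  qed
  also have "\<dots> = a + 1/2" using a unfolding cat_K_power2 by (simp add: field_simps power2_eq_square)
  finally have "N\<^sup>2 \<le> (cat_B' a S)\<^sup>2" unfolding cat_B'_power2 cat_B_power2 using aN by linarith
  then have NS: "N \<le> cat_B' a S" by (rule power2_le_imp_le) (use cat_B'_pos[of S] S1 in simp)
  have "\<tau> * N \<le> tanh (cat_phi a S) * cat_B' a S"
  proof (rule mult_mono[OF _ NS])
    show "\<tau> \<le> tanh (cat_phi a S)" using cat_phi_strict_mono[of 1 S] S1 by (cases "S = 1") (auto simp: \<tau>_def)
  qed (use N cat_phi_pos[of S] S1 in auto)
  then have hi: "cat_K a \<le> tanh (cat_phi a S) * cat_B' a S" using \<tau> by (simp add: N_def)
  have "\<exists>s. 0 \<le> s \<and> s \<le> S \<and> tanh (cat_phi a s) * cat_B' a s = cat_K a"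
    by (rule IVT') (use hi cat_K_pos S1 in \<open>auto simp: cat_phi_0 intro!: continuous_intros continuous_on_cat_phi continuous_on_cat_B'\<close>)
  then obtain s where s: "0 \<le> s" "tanh (cat_phi a s) * cat_B' a s = cat_K a" by blast
  have "s \<noteq> 0" using s cat_K_pos by (auto simp: cat_phi_0)
  then show "\<exists>s. s > 0 \<and> tanh (cat_phi a s) = cat_B a s * cat_K a / (a * sinh (2 * s))"
    using s by (intro exI[of _ s]) (simp add: cat_s0_equation_iff)
next
  have less: False if "0 < s" "s < t" "tanh (cat_phi a s) * cat_B' a s = cat_K a" "tanh (cat_phi a t) * cat_B' a t = cat_K a" for s t
  proof -
    have "tanh (cat_phi a s) * cat_B' a s < tanh (cat_phi a t) * cat_B' a t"
      using that cat_phi_strict_mono[of s t] cat_B'_strict_mono[of s t] cat_phi_pos[of s] cat_B'_pos[of s]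
      by (intro mult_strict_mono) auto
    then show False using that by simp
  qed
  fix s t
  assume "s > 0 \<and> tanh (cat_phi a s) = cat_B a s * cat_K a / (a * sinh (2 * s))"
    "t > 0 \<and> tanh (cat_phi a t) = cat_B a t * cat_K a / (a * sinh (2 * t))"
  then have "s > 0" "t > 0" "tanh (cat_phi a s) * cat_B' a s = cat_K a" "tanh (cat_phi a t) * cat_B' a t = cat_K a"
    using cat_s0_equation_iff by blast+
  then show "s = t" using less[of s t] less[of t s] by (cases s t rule: linorder_cases) blast+
qed

lemma cat_s0_pos: "cat_s0 a > 0"
  and cat_s0_eq: "tanh (cat_phi a (cat_s0 a)) * cat_B' a (cat_s0 a) = cat_K a"
  using theI'[OF ex1_cat_s0, folded cat_s0_def] cat_s0_equation_iff[of "cat_s0 a"] by blast+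

text \<open>
  The free boundary condition: position and conormal of the catenoid at the boundary are related by
  \<open>coth r\<close>. Algebraically, with \<open>y = B\<^sup>2\<close> and \<open>E = B'\<^sup>2\<close>, the equation \<open>tanh \<phi> = K / B'\<close> gives
  \<open>cosh\<^sup>2 \<phi> = E / (E - K\<^sup>2)\<close>, and \<open>y E = y\<^sup>2 + y - K\<^sup>2\<close> turns \<open>cosh\<^sup>2 r = (y + 1) cosh\<^sup>2 \<phi>\<close> into
  \<open>coth\<^sup>2 r = E / y\<close>.
\<close>
lemma coth_r_cat_B: "cosh (cat_r a) / sinh (cat_r a) * cat_B a (cat_s0 a) = cat_B' a (cat_s0 a)"
proof -
  let ?s = "cat_s0 a"
  define X where "X = cat_A a ?s * cosh (cat_phi a ?s)"
  define y where "y = (cat_B a ?s)\<^sup>2"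
  define E where "E = (cat_B' a ?s)\<^sup>2"
  have y: "y > 0" and B: "cat_B a ?s > 0" using cat_B_pos[of ?s] by (auto simp: y_def)
  have E: "E > 0" and B': "cat_B' a ?s > 0" using cat_B'_pos[OF cat_s0_pos] by (auto simp: E_def)
  have "(cat_A a ?s)\<^sup>2 > 1\<^sup>2" using cat_A_power2[of ?s] a_cosh_gt[of ?s] by simp
  then have "cat_A a ?s > 1" by (rule power2_less_imp_less) (use cat_A_pos[of ?s] in simp)
  then have X: "X > 1" unfolding X_def
    using cosh_real_ge_1[of "cat_phi a ?s"] by (metis less_le_trans less_1_mult mult.right_neutral order_le_less)
  have "\<exists>!r. r > 0 \<and> cosh r = X"
  proof (rule ex1I[of _ "arcosh X"])
    show "arcosh X > 0 \<and> cosh (arcosh X) = X" using X by simp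
    show "r = arcosh X" if "r > 0 \<and> cosh r = X" for r using that arcosh_cosh_real[of r] by auto
  qed
  from theI'[OF this] have r: "cat_r a > 0" "cosh (cat_r a) = X" unfolding cat_r_def X_def by auto
  have yE: "y * E = y\<^sup>2 + y - (cat_K a)\<^sup>2" using y
    by (simp add: E_def cat_B'_power2 flip: y_def) (simp add: field_simps power2_eq_square)
  have A2: "(cat_A a ?s)\<^sup>2 = y + 1" by (simp add: y_def cat_A_power2 cat_B_power2)
  have ch: "(cosh (cat_phi a ?s))\<^sup>2 * (E - (cat_K a)\<^sup>2) = E"
  proof -
    have "cosh (cat_phi a ?s) * cat_K a = sinh (cat_phi a ?s) * cat_B' a ?s"
      using cat_s0_eq by (simp add: tanh_def field_simps)
    then have "(cosh (cat_phi a ?s))\<^sup>2 * (cat_K a)\<^sup>2 = (sinh (cat_phi a ?s))\<^sup>2 * E"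
      by (simp add: E_def flip: power_mult_distrib)
    then show ?thesis by (simp add: sinh_square_eq algebra_simps)
  qed
  have "X\<^sup>2 * (E - (cat_K a)\<^sup>2) = (y + 1) * E" using ch A2 by (simp add: X_def power_mult_distrib)
  moreover have "E - (cat_K a)\<^sup>2 = (y + 1) * (E - y)" using yE by (simp add: algebra_simps power2_eq_square)
  ultimately have "(y + 1) * (X\<^sup>2 * (E - y)) = (y + 1) * E" by (simp add: algebra_simps)
  then have "X\<^sup>2 * (E - y) = E" using y by simp
  then have "X\<^sup>2 * y = E * (X\<^sup>2 - 1)" by (simp add: algebra_simps)
  then have "X\<^sup>2 * y = E * (sinh (cat_r a))\<^sup>2" using r by (simp add: sinh_square_eq)
  then have "(X * cat_B a ?s)\<^sup>2 = (cat_B' a ?s * sinh (cat_r a))\<^sup>2"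
    by (simp add: power_mult_distrib y_def E_def)
  then have "X * cat_B a ?s = cat_B' a ?s * sinh (cat_r a)"
    using X B B' r by (subst (asm) power2_eq_iff_nonneg) auto
  then show ?thesis using r by (simp add: field_simps)
qed

section \<open>A positive strict supersolution\<close>

lemma cat_B_even: "cat_B a (- s) = cat_B a s" by (simp add: cat_B_def)

lemma even_robin_problem_catenoid:
  "even_robin_problem (cat_B a) (\<lambda>s. cat_B a s * W2 a s) (cat_s0 a) (cat_B' a (cat_s0 a))"
proof
  show "continuous_on UNIV (\<lambda>s. cat_B a s * W2 a s)"
    unfolding W2_def using cat_B_pos
    by (intro continuous_intros continuous_on_cat_B) (auto simp: less_imp_neq[symmetric])
qed (auto simp: continuous_on_cat_B cat_B_pos cat_B_even W2_def cat_s0_pos cat_B'_pos)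

text \<open>
  For \<open>\<rho> = B + \<eta> / B\<^sup>2 - \<theta> / B\<close> the quantity \<open>(B \<rho>')' + B W\<^sub>2 \<rho>\<close> equals the left-hand side of the
  second assumption divided by \<open>B\<^sup>2\<close>. The powers \<open>B\<^sup>-\<^sup>2\<close> and \<open>B\<^sup>-\<^sup>1\<close> are chosen because for them the
  operator gives the single-signed terms \<open>- 4 K\<^sup>2 B\<^sup>-\<^sup>5\<close> and \<open>- (2 B\<^sup>2 + 3) B\<^sup>-\<^sup>2\<close>. The third assumption
  is the Robin inequality \<open>B \<rho>' \<ge> B' \<rho>\<close> at \<open>s\<^sub>0\<close>.
\<close>
lemma catenoid_supersolution:
  assumes rho: "\<And>s. 0 \<le> s \<Longrightarrow> cat_B a s + \<eta> / (cat_B a s)\<^sup>2 - \<theta> / cat_B a s > 0"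
    and neg: "\<And>s. 0 < s \<Longrightarrow> - 3 * (cat_B a s)\<^sup>2 + 2 * (cat_K a)\<^sup>2 + \<theta> * (2 * (cat_B a s)\<^sup>2 + 3)
       - 4 * \<eta> * (cat_K a)\<^sup>2 / (cat_B a s)^3 < 0"
    and bdry: "3 * \<eta> \<le> 2 * \<theta> * cat_B a (cat_s0 a)"
  shows "even_robin_problem.subcritical (cat_B a) (\<lambda>s. cat_B a s * W2 a s) (cat_s0 a) (cat_B' a (cat_s0 a)) 0"
proof -
  interpret even_robin_problem "cat_B a" "\<lambda>s. cat_B a s * W2 a s" "cat_s0 a" "cat_B' a (cat_s0 a)"
    by (rule even_robin_problem_catenoid)
  \<comment> \<open>First and second derivative of \<open>\<rho>\<close> as a function of \<open>B\<close>.\<close>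
  define R1 where "R1 s = 1 - 2 * \<eta> / (cat_B a s)^3 + \<theta> / (cat_B a s)\<^sup>2" for s
  define R2 where "R2 s = 6 * \<eta> / (cat_B a s)^4 - 2 * \<theta> / (cat_B a s)^3" for s
  have nz: "cat_B a s \<noteq> 0" for s using cat_B_pos[of s] by simp
  show ?thesis
  proof (rule supersolution_imp_subcritical_0[where \<rho>="\<lambda>s. cat_B a s + \<eta> / (cat_B a s)\<^sup>2 - \<theta> / cat_B a s"
      and Q="\<lambda>s. a * sinh (2 * s) * R1 s" and Q'="\<lambda>s. 2 * (a * cosh (2 * s)) * R1 s + a * sinh (2 * s) * (R2 s * cat_B' a s)"])
    fix s :: real
    show "cat_B a s + \<eta> / (cat_B a s)\<^sup>2 - \<theta> / cat_B a s > 0" if "0 \<le> s" by (rule rho[OF that])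
    show "((\<lambda>s. cat_B a s + \<eta> / (cat_B a s)\<^sup>2 - \<theta> / cat_B a s) has_real_derivative a * sinh (2 * s) * R1 s / cat_B a s) (at s)"
      by (rule derivative_eq_intros DERIV_cat_B refl nz | simp add: nz)+
         (use nz[of s] in \<open>simp add: R1_def cat_B'_def field_simps eval_nat_numeral\<close>)
    have dR1: "(R1 has_real_derivative R2 s * cat_B' a s) (at s)"
      unfolding R1_def[abs_def]
      by (rule derivative_eq_intros DERIV_cat_B refl nz | simp add: nz)+
         (use nz[of s] in \<open>simp add: R2_def field_simps eval_nat_numeral\<close>)
    show "((\<lambda>s. a * sinh (2 * s) * R1 s) has_real_derivative 2 * (a * cosh (2 * s)) * R1 s + a * sinh (2 * s) * (R2 s * cat_B' a s)) (at s)"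
      by (rule derivative_eq_intros dR1 refl | simp)+
    show "2 * (a * cosh (2 * s)) * R1 s + a * sinh (2 * s) * (R2 s * cat_B' a s) +
      cat_B a s * W2 a s * (cat_B a s + \<eta> / (cat_B a s)\<^sup>2 - \<theta> / cat_B a s) < 0" if "0 < s"
    proof -
      let ?b = "cat_B a s"
      have "2 * (a * cosh (2 * s)) = 2 * ?b\<^sup>2 + 1" by (simp add: cat_B_power2)
      moreover have "a * sinh (2 * s) * (R2 s * cat_B' a s) = (?b^4 + ?b\<^sup>2 - (cat_K a)\<^sup>2) / ?b * R2 s"
        by (simp add: cat_B'_def flip: a_sinh_power2) (simp add: power2_eq_square)
      ultimately have "2 * (a * cosh (2 * s)) * R1 s + a * sinh (2 * s) * (R2 s * cat_B' a s) +
        ?b * W2 a s * (?b + \<eta> / ?b\<^sup>2 - \<theta> / ?b) =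
        (2 * ?b\<^sup>2 + 1) * R1 s + (?b^4 + ?b\<^sup>2 - (cat_K a)\<^sup>2) / ?b * R2 s + ?b * W2 a s * (?b + \<eta> / ?b\<^sup>2 - \<theta> / ?b)" by simp
      also have "\<dots> = (- 3 * ?b\<^sup>2 + 2 * (cat_K a)\<^sup>2 + \<theta> * (2 * ?b\<^sup>2 + 3)
       - 4 * \<eta> * (cat_K a)\<^sup>2 / ?b^3) / ?b\<^sup>2"
        using nz[of s] by (simp add: R1_def R2_def W2_def divide_simps) algebra
      also have "\<dots> < 0" using neg[OF that] cat_B_pos[of s] by (simp add: divide_less_0_iff)
      finally show ?thesis .
    qed
    show "a * sinh (2 * 0) * R1 0 = 0" by simp
    show "a * sinh (2 * cat_s0 a) * R1 (cat_s0 a) \<ge> cat_B' a (cat_s0 a) *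
      (cat_B a (cat_s0 a) + \<eta> / (cat_B a (cat_s0 a))\<^sup>2 - \<theta> / cat_B a (cat_s0 a))"
    proof -
      let ?b = "cat_B a (cat_s0 a)"
      have b: "?b > 0" by (rule cat_B_pos)
      have "?b * R1 (cat_s0 a) - (?b + \<eta> / ?b\<^sup>2 - \<theta> / ?b) = (2 * \<theta> * ?b - 3 * \<eta>) / ?b\<^sup>2"
        using b by (simp add: R1_def field_simps power2_eq_square power3_eq_cube)
      then have "?b + \<eta> / ?b\<^sup>2 - \<theta> / ?b \<le> ?b * R1 (cat_s0 a)" using bdry b by (smt (verit) divide_nonneg_nonneg zero_le_power2)
      then have "cat_B' a (cat_s0 a) * (?b + \<eta> / ?b\<^sup>2 - \<theta> / ?b) \<le> cat_B' a (cat_s0 a) * (?b * R1 (cat_s0 a))"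
        using cat_B'_pos[OF cat_s0_pos] by (intro mult_left_mono) auto
      also have "\<dots> = a * sinh (2 * cat_s0 a) * R1 (cat_s0 a)" using b by (simp add: cat_B'_def)
      finally show ?thesis .
    qed
  qed
qed

lemma subcritical_a_le_1:
  assumes "a \<le> 1"
  shows "even_robin_problem.subcritical (cat_B a) (\<lambda>s. cat_B a s * W2 a s) (cat_s0 a) (cat_B' a (cat_s0 a)) 0"
proof (rule catenoid_supersolution[of 0 0])
  fix s :: real assume "0 < s"
  then have "(cat_B a 0)\<^sup>2 < (cat_B a s)\<^sup>2"
    using cat_B_strict_mono[of 0 s] cat_B_pos[of 0] by (intro power_strict_mono) auto
  moreover have "2 * (cat_K a)\<^sup>2 \<le> 3 * (a - 1/2)"
  proof -
    have "(a - 1/2) * (a + 1/2) \<le> (a - 1/2) * (3/2)" using a assms by (intro mult_left_mono) auto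
    then show ?thesis unfolding cat_K_power2 by (simp add: power2_eq_square algebra_simps)
  qed
  ultimately show "- 3 * (cat_B a s)\<^sup>2 + 2 * (cat_K a)\<^sup>2 + 0 * (2 * (cat_B a s)\<^sup>2 + 3) - 4 * 0 * (cat_K a)\<^sup>2 / (cat_B a s)^3 < 0"
    by (simp add: cat_B_power2)
qed (use cat_B_pos in auto)

text \<open>
  If \<open>B(s\<^sub>0) < 1\<close>, then \<open>s\<^sub>0\<close> comes too early for its equation: \<open>tanh \<phi>(s\<^sub>0) \<le> \<phi>'(0) s\<^sub>0\<close> and
  \<open>2 s\<^sub>0 \<le> sinh 2 s\<^sub>0\<close> reduce \<open>tanh \<phi> B' = K\<close> to
  \<open>2 a (a + 1/2) B(0) B(s\<^sub>0) \<le> (a sinh 2 s\<^sub>0)\<^sup>2 < 2 - K\<^sup>2\<close>, whereas the left-hand side is at least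
  \<open>2 K\<^sup>2 \<ge> 3/2\<close>.
\<close>
lemma cat_B_s0_ge_1:
  assumes "a \<ge> 1"
  shows "cat_B a (cat_s0 a) \<ge> 1"
proof (rule ccontr)
  assume "\<not> cat_B a (cat_s0 a) \<ge> 1"
  let ?s = "cat_s0 a" and ?b = "cat_B a (cat_s0 a)"
  have b: "0 < ?b" "?b < 1" using cat_B_pos[of ?s] \<open>\<not> ?b \<ge> 1\<close> by auto
  have s: "?s > 0" by (rule cat_s0_pos)
  have A0: "cat_A a 0 > 0" "(cat_A a 0)\<^sup>2 = a + 1/2" and B0: "cat_B a 0 > 0" "(cat_B a 0)\<^sup>2 = a - 1/2"
    using cat_A_pos[of 0] cat_B_pos[of 0] by (auto simp: cat_A_power2 cat_B_power2)
  define k where "k = cat_K a / ((a + 1/2) * cat_B a 0)"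
  have phi: "tanh (cat_phi a ?s) - k * ?s \<le> tanh (cat_phi a 0) - k * 0"
  proof (rule DERIV_nonpos_imp_nonincreasing[OF less_imp_le[OF s]])
    fix t assume t: "0 \<le> t" "t \<le> ?s"
    let ?D = "(1 - (tanh (cat_phi a t))\<^sup>2) * (cat_K a / ((cat_A a t)\<^sup>2 * cat_B a t)) - k"
    have "((\<lambda>t. tanh (cat_phi a t) - k * t) has_real_derivative ?D) (at t)"
      by (rule derivative_eq_intros DERIV_cat_phi refl | simp)+
    moreover have "?D \<le> 0"
    proof -
      have "cat_B a 0 \<le> cat_B a t" using cat_B_strict_mono[of 0 t] t by (cases "t = 0") auto
      moreover have "a + 1/2 \<le> (cat_A a t)\<^sup>2"
        unfolding cat_A_power2 using a cosh_real_ge_1[of "2 * t"] by simp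
      ultimately have "cat_K a / ((cat_A a t)\<^sup>2 * cat_B a t) \<le> k"
        unfolding k_def using a B0 cat_K_pos by (intro divide_left_mono mult_mono mult_pos_pos) auto
      moreover have "(1 - (tanh (cat_phi a t))\<^sup>2) * (cat_K a / ((cat_A a t)\<^sup>2 * cat_B a t)) \<le> 1 * (cat_K a / ((cat_A a t)\<^sup>2 * cat_B a t))"
        using cat_K_pos cat_A_pos[of t] cat_B_pos[of t] by (intro mult_right_mono) auto
      ultimately show ?thesis by linarith
    qed
    ultimately show "\<exists>y. ((\<lambda>t. tanh (cat_phi a t) - k * t) has_real_derivative y) (at t) \<and> y \<le> 0" by blast
  qed
  then have "tanh (cat_phi a ?s) \<le> k * ?s" by (simp add: cat_phi_0)
  also have "\<dots> \<le> k * (sinh (2 * ?s) / 2)"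
    using real_le_x_sinh[of "2 * ?s"] s a B0 cat_K_pos
    by (intro mult_left_mono) (auto simp: k_def sinh_field_def exp_minus)
  finally have "tanh (cat_phi a ?s) * cat_B' a ?s \<le> k * (sinh (2 * ?s) / 2) * cat_B' a ?s"
    using cat_B'_pos[OF s] by (intro mult_right_mono) auto
  then have "cat_K a \<le> k * (sinh (2 * ?s) / 2) * cat_B' a ?s" by (simp add: cat_s0_eq)
  moreover have "k * (sinh (2 * ?s) / 2) * cat_B' a ?s =
      cat_K a * ((sinh (2 * ?s) / 2) * cat_B' a ?s / ((a + 1/2) * cat_B a 0))"
    by (simp add: k_def mult_ac)
  ultimately have "cat_K a * 1 \<le> cat_K a * ((sinh (2 * ?s) / 2) * cat_B' a ?s / ((a + 1/2) * cat_B a 0))"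
    by linarith
  then have "1 \<le> (sinh (2 * ?s) / 2) * cat_B' a ?s / ((a + 1/2) * cat_B a 0)"
    using cat_K_pos by (rule mult_left_le_imp_le)
  then have "(a + 1/2) * cat_B a 0 \<le> (sinh (2 * ?s) / 2) * cat_B' a ?s"
    using a B0 by (subst (asm) le_divide_eq) auto
  then have "2 * a * ?b * ((a + 1/2) * cat_B a 0) \<le> 2 * a * ?b * ((sinh (2 * ?s) / 2) * cat_B' a ?s)"
    using a b by (intro mult_left_mono) auto
  also have "\<dots> = (a * sinh (2 * ?s))\<^sup>2" using b a by (simp add: cat_B'_def power2_eq_square)
  also have "\<dots> = ?b^4 + ?b\<^sup>2 - (cat_K a)\<^sup>2" by (rule a_sinh_power2)
  also have "\<dots> < 2 - (cat_K a)\<^sup>2"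
    using b power_strict_mono[of ?b 1 4] power_strict_mono[of ?b 1 2] by simp
  finally have 1: "2 * a * ?b * ((a + 1/2) * cat_B a 0) < 2 - (cat_K a)\<^sup>2" .
  have "2 * (cat_K a)\<^sup>2 \<le> 2 * a * ?b * ((a + 1/2) * cat_B a 0)"
  proof -
    have "(cat_K a)\<^sup>2 = (a + 1/2) * cat_B a 0 * cat_B a 0"
    proof -
      have "(cat_K a)\<^sup>2 = (a + 1/2) * (cat_B a 0)\<^sup>2"
        by (simp only: cat_K_power2 B0(2)) (simp add: power2_eq_square algebra_simps)
      then show ?thesis by (simp add: power2_eq_square mult.assoc)
    qed
    also have "\<dots> \<le> (a + 1/2) * cat_B a 0 * ?b"
      using cat_B_strict_mono[of 0 ?s] s B0 a by (intro mult_left_mono) auto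
    also have "\<dots> \<le> a * ((a + 1/2) * cat_B a 0 * ?b)"
      using mult_right_mono[OF assms, of "(a + 1/2) * cat_B a 0 * ?b"] a B0 b by simp
    finally show ?thesis by (simp add: algebra_simps)
  qed
  moreover have "(cat_K a)\<^sup>2 \<ge> 3/4"
    using power_mono[OF assms, of 2] by (simp add: cat_K_power2)
  ultimately show False using 1 by linarith
qed

text \<open>
  With \<open>\<eta> = 2 \<theta> / 3\<close> the Robin inequality is \<open>B(s\<^sub>0) \<ge> 1\<close>. At \<open>a = 1\<close> and \<open>y = 1/2\<close> the expression to
  be made negative vanishes for \<open>\<theta> = 0\<close> and has \<open>\<theta>\<close>-derivative \<open>4 - 4 \<surd>2 < 0\<close>; the value
  \<open>\<theta> = 1/10\<close> is small enough for \<open>- 3 y\<close> to dominate for larger \<open>y\<close>, and it leaves room for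
  \<open>a \<le> 101/100\<close>.
\<close>
lemma subcritical_a_ge_1:
  assumes "a \<ge> 1" "a \<le> 101/100"
  shows "even_robin_problem.subcritical (cat_B a) (\<lambda>s. cat_B a s * W2 a s) (cat_s0 a) (cat_B' a (cat_s0 a)) 0"
proof (rule catenoid_supersolution[of "1/15" "1/10"])
  fix s :: real assume "0 \<le> s"
  let ?b = "cat_B a s"
  have b: "?b > 0" by (rule cat_B_pos)
  have "a * 1 \<le> a * cosh (2 * s)" using assms by (intro mult_left_mono cosh_real_ge_1) auto
  then have b2: "?b\<^sup>2 \<ge> 1/2" using assms unfolding cat_B_power2 by linarith
  have "?b\<^sup>2 - 1/10 > 0" using b2 by simp
  then have "(?b\<^sup>2 - 1/10) / ?b > 0" using b by (intro divide_pos_pos)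
  moreover have "(?b\<^sup>2 - 1/10) / ?b = ?b - 1/10 / ?b" using b by (simp add: field_simps power2_eq_square)
  moreover have "1/15 / ?b\<^sup>2 > 0" using b by simp
  ultimately show "?b + 1/15 / ?b\<^sup>2 - 1/10 / ?b > 0" by linarith
next
  fix s :: real assume "0 < s"
  let ?b = "cat_B a s"
  have b: "?b > 0" by (rule cat_B_pos)
  have "a * 1 \<le> a * cosh (2 * s)" using assms by (intro mult_left_mono cosh_real_ge_1) auto
  then have b2: "?b\<^sup>2 \<ge> 1/2" using assms unfolding cat_B_power2 by linarith
  have K1: "(cat_K a)\<^sup>2 \<ge> 3/4" using power_mono[OF assms(1), of 2] by (simp add: cat_K_power2)
  have K2: "(cat_K a)\<^sup>2 \<le> 7701/10000"
    using power_mono[OF assms(2), of 2] assms(1) unfolding cat_K_power2 by (simp add: power2_eq_square)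
  \<comment> \<open>The inequality to be shown, after inserting the bounds for \<open>K\<^sup>2\<close>, multiplied by \<open>- 10 B\<^sup>3\<close>.\<close>
  have poly: "28 * t^5 - 18402/1000 * t^3 + 2 > 0" if t: "t > 0" "t\<^sup>2 \<ge> 1/2" for t :: real
  proof -
    have e: "28 * t^5 - 18402/1000 * t^3 = t^3 * (28 * t\<^sup>2 - 18402/1000)"
      by (simp add: algebra_simps flip: power_add)
    consider "t \<le> 3/4" | "3/4 \<le> t" "28 * t\<^sup>2 \<le> 18402/1000" | "28 * t\<^sup>2 \<ge> 18402/1000" by linarith
    then show ?thesis
    proof cases
      case 1
      have "t^3 * (18402/1000 - 28 * t\<^sup>2) \<le> (3/4)^3 * (18402/1000 - 28 * (1/2))"
      proof (cases "18402/1000 - 28 * t\<^sup>2 \<ge> 0")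
        case True
        then show ?thesis using t 1 by (intro mult_mono power_mono) auto
      next
        case False
        then have "t^3 * (18402/1000 - 28 * t\<^sup>2) \<le> 0" using t by (intro mult_nonneg_nonpos) auto
        then show ?thesis by (simp add: power3_eq_cube)
      qed
      then show ?thesis using e by (simp add: power3_eq_cube algebra_simps)
    next
      case 2
      have "t\<^sup>2 < (82/100)\<^sup>2" using 2 by (simp add: power2_eq_square)
      then have "t < 82/100" by (rule power2_less_imp_less) simp
      have "(3/4)\<^sup>2 \<le> t\<^sup>2" using 2 by (intro power_mono) auto
      then have "t^3 * (18402/1000 - 28 * t\<^sup>2) \<le> (82/100)^3 * (18402/1000 - 28 * (3/4)\<^sup>2)"
        using t 2 \<open>t < 82/100\<close> by (intro mult_mono power_mono) auto
      then show ?thesis using e by (simp add: power3_eq_cube power2_eq_square algebra_simps)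
    next
      case 3
      then have "t^3 * (28 * t\<^sup>2 - 18402/1000) \<ge> 0" using t by (intro mult_nonneg_nonneg) auto
      then show ?thesis using e by linarith
    qed
  qed
  have "4 * (1/15) * (cat_K a)\<^sup>2 / ?b^3 \<ge> (1/5) / ?b^3"
    using K1 b by (intro divide_right_mono) auto
  then have "- 3 * ?b\<^sup>2 + 2 * (cat_K a)\<^sup>2 + 1/10 * (2 * ?b\<^sup>2 + 3) - 4 * (1/15) * (cat_K a)\<^sup>2 / ?b^3
    \<le> - (28/10) * ?b\<^sup>2 + 18402/10000 - (1/5) / ?b^3"
    using K2 by (simp add: algebra_simps)
  also have "\<dots> = - (28 * ?b^5 - 18402/1000 * ?b^3 + 2) / (10 * ?b^3)"
    using b by (simp add: field_simps flip: power_add)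
  also have "\<dots> < 0" using poly[OF b b2] b by (simp add: divide_less_0_iff)
  finally show "- 3 * ?b\<^sup>2 + 2 * (cat_K a)\<^sup>2 + 1/10 * (2 * ?b\<^sup>2 + 3) - 4 * (1/15) * (cat_K a)\<^sup>2 / ?b^3 < 0" .
next
  show "3 * (1/15) \<le> 2 * (1/10) * cat_B a (cat_s0 a)" using cat_B_s0_ge_1[OF assms(1)] by simp
qed

section \<open>Positivity of the lowest even eigenvalue\<close>

text \<open>
  The shooting ground state is the eigenfunction of least eigenvalue. The form is evaluated
  with a weak derivative that is chosen arbitrarily, so the classical derivative of the ground state
  enters through the almost everywhere uniqueness of weak derivatives.
\<close>
lemma mu0_even_pos:
  assumes "even_robin_problem.subcritical (cat_B a) (\<lambda>s. cat_B a s * W2 a s) (cat_s0 a) (cat_B' a (cat_s0 a)) 0"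
  shows "mu0_even a > 0"
proof -
  let ?c = "cat_s0 a"
  interpret even_robin_problem "cat_B a" "\<lambda>s. cat_B a s * W2 a s" ?c "cat_B' a ?c"
    by (rule even_robin_problem_catenoid)
  obtain \<mu> where \<mu>: "\<mu> > 0" "\<And>x. \<bar>x\<bar> \<le> ?c \<Longrightarrow> sol \<mu> x > 0" "flux \<mu> ?c = cat_B' a ?c * sol \<mu> ?c"
    using ground_state_exists[OF assms] by blast
  have S2: "S2_rad a u v = (LBINT s:{-?c<..<?c}. cat_B a s * (weak_deriv ?c u s * weak_deriv ?c v s) - cat_B a s * W2 a s * (u s * v s))
     - cat_B' a ?c * (u ?c * v ?c + u (- ?c) * v (- ?c))" for u v
    by (simp only: S2_rad_def Let_def coth_r_cat_B)
  have wd: "is_weak_deriv ?c u (weak_deriv ?c u)" if "u \<in> H1 ?c" for u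
    using that unfolding H1_def weak_deriv_def by (metis (mono_tags, lifting) mem_Collect_eq someI_ex)
  have prim: "primitive_on (- ?c) ?c u (weak_deriv ?c u)" "L2_on {-?c<..<?c} (weak_deriv ?c u)" "continuous_on {-?c..?c} u"
    if "u \<in> H1 ?c" for u
    using is_weak_deriv_imp_primitive_on[OF cat_s0_pos _ wd[OF that]] wd[OF that] that
    by (auto simp: H1_def is_weak_deriv_def)
  let ?w = "sol \<mu>" and ?w' = "\<lambda>s. flux \<mu> s / cat_B a s"
  have w'c: "continuous_on {-?c..?c} ?w'"
    using cat_B_pos by (intro continuous_intros continuous_on_flux continuous_on_cat_B) (auto simp: less_imp_neq[symmetric])
  have w_wd: "is_weak_deriv ?c ?w ?w'"
    by (rule C1_is_weak_deriv[OF cat_s0_pos _ w'c], rule DERIV_sol) auto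
  then have w_H1: "?w \<in> H1 ?c"
    using continuous_on_sol continuous_imp_L2_on[OF continuous_on_sol] by (auto simp: H1_def)
  have w_even: "?w \<in> H1_even ?c" using w_H1 sol_even by (auto simp: H1_even_def)
  have "even_eigenvalue a \<mu>"
    unfolding even_eigenvalue_def
  proof (intro bexI[OF _ w_even] conjI ballI)
    show "\<exists>s\<in>{- ?c..?c}. ?w s \<noteq> 0" using cat_s0_pos by (intro bexI[of _ 0]) auto
    fix v assume "v \<in> H1_even ?c"
    then have v: "v \<in> H1 ?c" by (simp add: H1_even_def)
    have ae: "AE s in lborel. s \<in> {-?c<..<?c} \<longrightarrow> weak_deriv ?c ?w s = ?w' s"
      by (rule primitive_on_AE_unique[OF _ prim(1)[OF w_H1] is_weak_deriv_imp_primitive_on[OF cat_s0_pos continuous_on_sol w_wd]])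
         (use cat_s0_pos in simp)
    have "(LBINT s:{-?c<..<?c}. cat_B a s * (weak_deriv ?c ?w s * weak_deriv ?c v s) - cat_B a s * W2 a s * (?w s * v s))
      = (LBINT s:{-?c<..<?c}. cat_B a s * (?w' s * weak_deriv ?c v s) - cat_B a s * W2 a s * (?w s * v s))"
    proof -
      have mc: "set_borel_measurable lborel {-?c<..<?c} f" if "continuous_on {-?c..?c} f" for f :: "real \<Rightarrow> real"
        using continuous_imp_L2_on[OF that] by (simp add: L2_on_def)
      have mL: "set_borel_measurable lborel {-?c<..<?c} f" if "L2_on {-?c<..<?c} f" for f
        using that by (simp add: L2_on_def)
      have cV: "continuous_on {-?c..?c} (\<lambda>s. cat_B a s * W2 a s)"
        by (rule continuous_on_subset[OF continuous_V]) auto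
      have "set_borel_measurable lborel {-?c<..<?c} (\<lambda>s. cat_B a s * (d s * weak_deriv ?c v s) - cat_B a s * W2 a s * (?w s * v s))"
        if "set_borel_measurable lborel {-?c<..<?c} d" for d
        by (intro set_borel_measurable_mult set_borel_measurable_diff that mc[OF continuous_on_cat_B]
          mc[OF cV] mc[OF continuous_on_sol] mc[OF prim(3)[OF v]] mL[OF prim(2)[OF v]])
      from this[OF mL[OF prim(2)[OF w_H1]]] this[OF mc[OF w'c]] show ?thesis
        unfolding set_lebesgue_integral_def set_borel_measurable_def
        by (rule integral_cong_AE) (use ae in eventually_elim, auto split: split_indicator)
    qed
    then show "S2_rad a ?w v = \<mu> * B_inner a ?w v"
      unfolding S2 B_inner_def using ground_state_weak_equation[OF \<mu>(3) prim(3)[OF v] prim(1)[OF v]] by simp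
  qed
  moreover have "\<mu> \<le> \<nu>" if "even_eigenvalue a \<nu>" for \<nu>
  proof -
    from that obtain u where "u \<in> H1_even ?c" "\<exists>s\<in>{-?c..?c}. u s \<noteq> 0"
        "\<forall>v\<in>H1_even ?c. S2_rad a u v = \<nu> * B_inner a u v"
      unfolding even_eigenvalue_def by (elim bexE conjE) blast
    then obtain s where u: "u \<in> H1_even ?c" "s \<in> {-?c..?c}" "u s \<noteq> 0" "S2_rad a u u = \<nu> * B_inner a u u"
      by auto
    then have "u \<in> H1 ?c" by (simp add: H1_even_def)
    note p = prim[OF this]
    have "\<mu> * B_inner a u u \<le> \<nu> * B_inner a u u"
      using ground_state_minimal[OF \<mu>(2,3) p(3,1,2)] u(4) unfolding S2 B_inner_def by simp
    moreover have "B_inner a u u > 0"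
    proof -
      have cont: "continuous_on {-?c..?c} (\<lambda>s. cat_B a s * (u s * u s))"
        by (intro continuous_intros continuous_on_cat_B p(3))
      have "B_inner a u u = (LBINT s=-?c..?c. cat_B a s * (u s * u s))"
        using cat_s0_pos by (simp add: B_inner_def interval_integral_Ioo)
      also have "\<dots> = integral {-?c..?c} (\<lambda>s. cat_B a s * (u s * u s))"
        using cat_s0_pos borel_integrable_atLeastAtMost'[OF cont] by (intro interval_integral_eq_integral) auto
      finally have eq: "B_inner a u u = integral {-?c..?c} (\<lambda>s. cat_B a s * (u s * u s))" .
      have nn: "cat_B a s * (u s * u s) \<ge> 0" for s using cat_B_pos[of s] by simp
      have "integral {-?c..?c} (\<lambda>s. cat_B a s * (u s * u s)) \<ge> 0"
        using nn by (intro integral_nonneg integrable_continuous_real cont) auto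
      moreover have "integral {-?c..?c} (\<lambda>s. cat_B a s * (u s * u s)) \<noteq> 0"
      proof
        assume "integral {-?c..?c} (\<lambda>s. cat_B a s * (u s * u s)) = 0"
        then have "\<forall>s\<in>{-?c..?c}. cat_B a s * (u s * u s) = 0"
          using integral_eq_0_iff[OF cont _ nn] cat_s0_pos by simp
        then show False using u(2,3) cat_B_pos[of s] by fastforce
      qed
      ultimately show ?thesis using eq by simp
    qed
    ultimately show ?thesis by simp
  qed
  ultimately have "mu0_even a = \<mu>" unfolding mu0_even_def by (rule Least_equality)
  then show ?thesis using \<mu>(1) by simp
qed

end

theorem theorem9p7:
  "\<exists>A :: real. A > 1 \<and> (\<forall>a\<in>{1/2<..A}. mu0_even a > 0)"
proof (intro exI[of _ "101/100"] conjI ballI)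
  fix a :: real assume "a \<in> {1/2<..101/100}"
  then have "a > 1/2" "a \<le> 101/100" by auto
  then show "mu0_even a > 0"
    using mu0_even_pos[of a] subcritical_a_le_1[of a] subcritical_a_ge_1[of a] by linarith
qed simp

end
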